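(* Using the following algorithm, the task ListSep (given an ancestral graph $G=(V,E)$ with $n$ nodes and $m$ edges, pairwise disjoint sets $X,Y,R\subseteq V$ with $X,Y$ non-empty, and a set $I\subseteq R$, enumerate all $m$-separators $Z$ relative to $(X,Y)$ with $I\subseteq Z\subseteq R$) can be solved with polynomial delay $O(n(n+m))$. Algorithm ListSep$(G,X,Y,I,R)$: If FindSep$(G,X,Y,I,R)\neq\bot$, then: if $I=R$, output $I$; otherwise let $v$ be an arbitrary node of $R\setminus I$, call ListSep$(G,X,Y,I\cup\{v\},R)$, and then call ListSep$(G,X,Y,I,R\setminus\{v\})$.
   Context: A mixed graph has directed ($A\to B$), undirected ($A-B$) and bidirected ($A\leftrightarrow B$) edges. A path is a sequence of distinct nodes with consecutive nodes adjacent; adjacent nodes are neighbors. $U$ is an ancestor of $W$ if there is a directed path $U\to\cdots\to W$; $U$ is an anterior of $W$ if there is a path from $U$ to $W$ that becomes directed after replacing each undirected edge $S-T$ on it (traversed from $S$ to $T$) by $S\to T$. Every node is its own ancestor and anterior; $An(S)$, $Ant(S)$ are the ancestor and anterior sets of $S$. A mixed graph is an ancestral graph if (1) for each edge $A\gets B$ or $A\leftrightarrow B$, $A$ is not an anterior of $B$, and (2) for each edge $A-B$ there are no edges $A\gets C$, $A\leftrightarrow C$, $B\gets C$ or $B\leftrightarrow C$. A node on a path is a collider if two arrowheads of the path meet at it. Nodes $U,W$ are $m$-connected by $Z$ if there is a path between them on which every collider is in $An(Z)$ and every non-collider is not in $Z$; otherwise $Z$ $m$-separates them. $Z$ is an $m$-separator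 relative to $(X,Y)$ (it $m$-separates $X$ and $Y$) if it $m$-separates every $U\in X$ from every $W\in Y$. FindSep$(G,X,Y,I,R)$ is the following procedure: let $R'=R\setminus(X\cup Y)$ and $Z=Ant(X\cup Y\cup I)\cap R'$; if TestSep$(G,X,Y,Z)$ returns true, return $Z$, otherwise return $\bot$. TestSep$(G,X,Y,Z)$ is the following procedure, which decides whether $Z$ $m$-separates $X$ and $Y$: let $P=\{(\gets,x):x\in X\}$ and $Q=P$. While $P$ is not empty: remove a pair $(e,T)$ from $P$; for every neighbor $N$ of $T$, with $f$ the edge between $T$ and $N$ (type read from $T$ to $N$), if $e,T,f$ is $m$-connecting and $(f,N)\notin Q$, add $(f,N)$ to $P$ and $Q$; then, if $T\in Y$, return false. When $P$ is empty, return true. Here $e$ is an edge type read in the direction in which $T$ is entered, and $e,T,f$ is $m$-connecting if either $T\notin Z$ and $e,f$ do not both have an arrowhead at $T$, or $T\in Z$ and both have an arrowhead at $T$ ($f$ may be the edge through which $T$ was entered). Delay $O(f)$ means that at most $O(f)$ time passes between the start of the algorithm or the output of a solution and the output of the next solution or the end of the algorithm. *)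

theory Defs
  imports Main "HOL-Library.Monad_Syntax"
begin

section \<open>Mixed graphs and ancestral graphs\<close>

text \<open>Undirected and bidirected edges are unordered pairs, so every edge is counted once.\<close>

record 'a mixed_graph =
  nodes :: "'a set"
  directed :: "('a \<times> 'a) set"
  undirected :: "'a set set"
  bidirected :: "'a set set"

definition mixed_graph :: "'a mixed_graph \<Rightarrow> bool" where
  "mixed_graph G \<longleftrightarrow>
     finite (nodes G) \<and>
     directed G \<subseteq> {(a, b). a \<in> nodes G \<and> b \<in> nodes G \<and> a \<noteq> b} \<and>
     undirected G \<subseteq> {{a, b} | a b. a \<in> nodes G \<and> b \<in> nodes G \<and> a \<noteq> b} \<and>
     bidirected G \<subseteq> {{a, b} | a b. a \<in> nodes G \<and> b \<in> nodes G \<and> a \<noteq> b}"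

definition num_nodes :: "'a mixed_graph \<Rightarrow> nat" where
  "num_nodes G = card (nodes G)"

definition num_edges :: "'a mixed_graph \<Rightarrow> nat" where
  "num_edges G = card (directed G) + card (undirected G) + card (bidirected G)"

text \<open>The type of an edge depends on the direction in which the edge is read: \<open>Forward\<close> is
  \<open>A \<rightarrow> B\<close> and \<open>Backward\<close> is \<open>A \<leftarrow> B\<close> when the edge is read from \<open>A\<close> to \<open>B\<close>.\<close>

datatype edge_type = Forward | Backward | Undirected | Bidirected

fun edge :: "'a mixed_graph \<Rightarrow> 'a \<Rightarrow> edge_type \<Rightarrow> 'a \<Rightarrow> bool" where
  "edge G A Forward B \<longleftrightarrow> (A, B) \<in> directed G"
| "edge G A Backward B \<longleftrightarrow> (B, A) \<in> directed G"
| "edge G A Undirected B \<longleftrightarrow> {A, B} \<in> undirected G"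
| "edge G A Bidirected B \<longleftrightarrow> {A, B} \<in> bidirected G"

definition arrowhead_at_source :: "edge_type \<Rightarrow> bool" where
  "arrowhead_at_source e \<longleftrightarrow> e = Backward \<or> e = Bidirected"

definition arrowhead_at_target :: "edge_type \<Rightarrow> bool" where
  "arrowhead_at_target e \<longleftrightarrow> e = Forward \<or> e = Bidirected"

text \<open>In a path, \<open>es ! i\<close> is the type of the edge used from \<open>ps ! i\<close> to \<open>ps ! Suc i\<close>. Listing
  the edges makes the notion unambiguous even if two nodes are joined by several edges; in an
  ancestral graph they are determined by the nodes. A single node is a path.\<close>

definition path :: "'a mixed_graph \<Rightarrow> 'a list \<Rightarrow> edge_type list \<Rightarrow> bool" where
  "path G ps es \<longleftrightarrow>
     length ps = Suc (length es) \<and> distinct ps \<and> set ps \<subseteq> nodes G \<and>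
     (\<forall>i < length es. edge G (ps ! i) (es ! i) (ps ! Suc i))"

definition ancestor :: "'a mixed_graph \<Rightarrow> 'a \<Rightarrow> 'a \<Rightarrow> bool" where
  "ancestor G U W \<longleftrightarrow>
     (\<exists>ps es. path G ps es \<and> hd ps = U \<and> last ps = W \<and> set es \<subseteq> {Forward})"

definition anterior :: "'a mixed_graph \<Rightarrow> 'a \<Rightarrow> 'a \<Rightarrow> bool" where
  "anterior G U W \<longleftrightarrow>
     (\<exists>ps es. path G ps es \<and> hd ps = U \<and> last ps = W \<and> set es \<subseteq> {Forward, Undirected})"

definition An :: "'a mixed_graph \<Rightarrow> 'a set \<Rightarrow> 'a set" where
  "An G S = {U. \<exists>W\<in>S. ancestor G U W}"

definition ancestral_graph :: "'a mixed_graph \<Rightarrow> bool" where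
  "ancestral_graph G \<longleftrightarrow>
     mixed_graph G \<and>
     (\<forall>A B. edge G A Backward B \<or> edge G A Bidirected B \<longrightarrow> \<not> anterior G A B) \<and>
     (\<forall>A B. edge G A Undirected B \<longrightarrow>
        (\<forall>C. \<not> edge G A Backward C \<and> \<not> edge G A Bidirected C \<and>
             \<not> edge G B Backward C \<and> \<not> edge G B Bidirected C))"


section \<open>m-separation\<close>

text \<open>Whether the \<open>i\<close>-th node of a path is a collider depends only on the edges; the two
  endpoints are never colliders.\<close>

definition collider :: "edge_type list \<Rightarrow> nat \<Rightarrow> bool" where
  "collider es i \<longleftrightarrow>
     0 < i \<and> i < length es \<and> arrowhead_at_target (es ! (i - 1)) \<and> arrowhead_at_source (es ! i)"

definition m_connected :: "'a mixed_graph \<Rightarrow> 'a set \<Rightarrow> 'a \<Rightarrow> 'a \<Rightarrow> bool" where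
  "m_connected G Z U W \<longleftrightarrow>
     (\<exists>ps es. path G ps es \<and> hd ps = U \<and> last ps = W \<and>
        (\<forall>i < length ps. if collider es i then ps ! i \<in> An G Z else ps ! i \<notin> Z))"

definition m_separator :: "'a mixed_graph \<Rightarrow> 'a set \<Rightarrow> 'a set \<Rightarrow> 'a set \<Rightarrow> bool" where
  "m_separator G X Y Z \<longleftrightarrow> (\<forall>U\<in>X. \<forall>W\<in>Y. \<not> m_connected G Z U W)"


section \<open>Nondeterministic computations with time and output\<close>

text \<open>A computation is the set of outcomes of its possible runs. A run that stops yields the
  sequence of its events, in temporal order, and a result; \<open>Tick\<close> is one unit of time. \<open>Fail\<close>
  stands for a run that does not stop or gets stuck. All nondeterministic choices are
  universally quantified in the correctness statement below.\<close>

datatype 'o event = Tick | Output 'o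

datatype ('o, 'a) outcome = Fail | Result "'o event list" 'a

type_synonym ('o, 'a) comp = "('o, 'a) outcome set"

definition return :: "'a \<Rightarrow> ('o, 'a) comp" where
  "return x = {Result [] x}"

fun prepend :: "'o event list \<Rightarrow> ('o, 'a) outcome \<Rightarrow> ('o, 'a) outcome" where
  "prepend t Fail = Fail"
| "prepend t (Result u y) = Result (t @ u) y"

definition bind_comp :: "('o, 'a) comp \<Rightarrow> ('a \<Rightarrow> ('o, 'b) comp) \<Rightarrow> ('o, 'b) comp" where
  "bind_comp c f = (\<Union>r\<in>c. case r of Fail \<Rightarrow> {Fail} | Result t x \<Rightarrow> prepend t ` f x)"

no_adhoc_overloading
  Monad_Syntax.bind \<rightleftharpoons> Set.bind

adhoc_overloading
  Monad_Syntax.bind \<rightleftharpoons> bind_comp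

definition elapse :: "nat \<Rightarrow> ('o, unit) comp" where
  "elapse k = {Result (replicate k Tick) ()}"

definition emit :: "'o \<Rightarrow> ('o, unit) comp" where
  "emit z = {Result [Output z] ()}"

text \<open>\<open>iterates b c s t s'\<close>: some number of complete iterations of the loop
  \<open>while b do c\<close> lead from \<open>s\<close> to \<open>s'\<close>, with events \<open>t\<close>. Each test of \<open>b\<close> costs a tick.\<close>

inductive iterates ::
  "('s \<Rightarrow> bool) \<Rightarrow> ('s \<Rightarrow> ('o, 's) comp) \<Rightarrow> 's \<Rightarrow> 'o event list \<Rightarrow> 's \<Rightarrow> bool"
  for b c s where
  start: "iterates b c s [] s"
| iterate: "iterates b c s t s' \<Longrightarrow> b s' \<Longrightarrow> Result u s'' \<in> c s' \<Longrightarrow>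
     iterates b c s (t @ Tick # u) s''"

definition while :: "('s \<Rightarrow> bool) \<Rightarrow> ('s \<Rightarrow> ('o, 's) comp) \<Rightarrow> 's \<Rightarrow> ('o, 's) comp" where
  "while b c s =
     {Result (t @ [Tick]) s' | t s'. iterates b c s t s' \<and> \<not> b s'} \<union>
     {Fail | t s'. iterates b c s t s' \<and> b s' \<and> Fail \<in> c s'} \<union>
     {Fail | \<sigma>. \<sigma> 0 = s \<and> (\<forall>i. b (\<sigma> i) \<and> (\<exists>u. Result u (\<sigma> (Suc i)) \<in> c (\<sigma> i)))}"


subsection \<open>Cost of the elementary operations\<close>

text \<open>The costs are those of a unit-cost random access machine that stores a subset of a finite
  universe as a bit vector together with a linked list of its members: operations on a single
  element take one unit of time, operations that create, combine, compare or print whole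
  sets take one unit for each element of the universe \<open>V\<close>. The single-element updates are
  destructive; below, the argument of such an update is never used again afterwards.\<close>

definition pick :: "'a set \<Rightarrow> ('o, 'a) comp" where
  "pick S = (if finite S \<and> S \<noteq> {} then {Result [Tick] x | x. x \<in> S} else {Fail})"

definition test_elem :: "'a \<Rightarrow> 'a set \<Rightarrow> ('o, bool) comp" where
  "test_elem x S = do { elapse 1; return (x \<in> S) }"

definition add_elem :: "'a \<Rightarrow> 'a set \<Rightarrow> ('o, 'a set) comp" where
  "add_elem x S = do { elapse 1; return (insert x S) }"

definition remove_elem :: "'a \<Rightarrow> 'a set \<Rightarrow> ('o, 'a set) comp" where
  "remove_elem x S = do { elapse 1; return (S - {x}) }"

definition new_set :: "'a set \<Rightarrow> ('o, 'a set) comp" where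
  "new_set V = do { elapse (card V); return {} }"

definition copy_set :: "'a set \<Rightarrow> 'a set \<Rightarrow> ('o, 'a set) comp" where
  "copy_set V A = do { elapse (card V); return A }"

definition union_set :: "'a set \<Rightarrow> 'a set \<Rightarrow> 'a set \<Rightarrow> ('o, 'a set) comp" where
  "union_set V A B = do { elapse (card V); return (A \<union> B) }"

definition inter_set :: "'a set \<Rightarrow> 'a set \<Rightarrow> 'a set \<Rightarrow> ('o, 'a set) comp" where
  "inter_set V A B = do { elapse (card V); return (A \<inter> B) }"

definition diff_set :: "'a set \<Rightarrow> 'a set \<Rightarrow> 'a set \<Rightarrow> ('o, 'a set) comp" where
  "diff_set V A B = do { elapse (card V); return (A - B) }"

definition equal_set :: "'a set \<Rightarrow> 'a set \<Rightarrow> 'a set \<Rightarrow> ('o, bool) comp" where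
  "equal_set V A B = do { elapse (card V); return (A = B) }"

definition print_set :: "'a set \<Rightarrow> 'a set \<Rightarrow> ('a set, unit) comp" where
  "print_set V A = do { elapse (card V); emit A }"

text \<open>A loop over the elements of \<open>S\<close> in any order; it walks along the list of members (for
  \<open>incident\<close> below, along an adjacency list) and leaves the set itself unchanged.\<close>

definition foreach :: "'b set \<Rightarrow> ('b \<Rightarrow> 's \<Rightarrow> ('o, 's) comp) \<Rightarrow> 's \<Rightarrow> ('o, 's) comp" where
  "foreach S f s = do {
     (_, s') \<leftarrow> while (\<lambda>(todo, _). todo \<noteq> {})
       (\<lambda>(todo, s). do {
          x \<leftarrow> pick todo;
          todo \<leftarrow> remove_elem x todo;
          s \<leftarrow> f x s;
          return (todo, s) })
       (S, s);
     return s' }"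


section \<open>The algorithms\<close>

definition incident :: "'a mixed_graph \<Rightarrow> 'a \<Rightarrow> (edge_type \<times> 'a) set" where
  "incident G T = {(f, N). edge G T f N}"

text \<open>Here \<open>z\<close> tells whether the middle node is in the separator; the first edge is read towards
  the middle node and the second one away from it.\<close>

definition m_connecting :: "edge_type \<Rightarrow> bool \<Rightarrow> edge_type \<Rightarrow> bool" where
  "m_connecting e z f \<longleftrightarrow>
     (\<not> z \<and> \<not> (arrowhead_at_target e \<and> arrowhead_at_source f)) \<or>
     (z \<and> arrowhead_at_target e \<and> arrowhead_at_source f)"

text \<open>The flag \<open>sep\<close> becomes false when the loop is left early with the answer false.\<close>

definition TestSep ::
  "'a mixed_graph \<Rightarrow> 'a set \<Rightarrow> 'a set \<Rightarrow> 'a set \<Rightarrow> ('o, bool) comp" where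
  "TestSep G X Y Z = do {
     P \<leftarrow> new_set (UNIV \<times> nodes G);
     P \<leftarrow> foreach X (\<lambda>x P. add_elem (Backward, x) P) P;
     Q \<leftarrow> copy_set (UNIV \<times> nodes G) P;
     (_, _, sep) \<leftarrow> while (\<lambda>(P, Q, sep). sep \<and> P \<noteq> {})
       (\<lambda>(P, Q, sep). do {
          (e, T) \<leftarrow> pick P;
          P \<leftarrow> remove_elem (e, T) P;
          (P, Q) \<leftarrow> foreach (incident G T)
            (\<lambda>(f, N) (P, Q). do {
               z \<leftarrow> test_elem T Z;
               old \<leftarrow> test_elem (f, N) Q;
               if m_connecting e z f \<and> \<not> old then do {
                 P \<leftarrow> add_elem (f, N) P;
                 Q \<leftarrow> add_elem (f, N) Q;
                 return (P, Q) }
               else return (P, Q) })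
            (P, Q);
          y \<leftarrow> test_elem T Y;
          return (P, Q, \<not> y) })
       (P, Q, True);
     return sep }"

text \<open>Graph search for the set of all anteriors of nodes of \<open>S\<close>: edges are followed backwards.\<close>

definition Anteriors :: "'a mixed_graph \<Rightarrow> 'a set \<Rightarrow> ('o, 'a set) comp" where
  "Anteriors G S = do {
     P \<leftarrow> copy_set (nodes G) S;
     A \<leftarrow> copy_set (nodes G) S;
     (_, A) \<leftarrow> while (\<lambda>(P, _). P \<noteq> {})
       (\<lambda>(P, A). do {
          T \<leftarrow> pick P;
          P \<leftarrow> remove_elem T P;
          foreach (incident G T)
            (\<lambda>(f, N) (P, A). do {
               old \<leftarrow> test_elem N A;
               if (f = Backward \<or> f = Undirected) \<and> \<not> old then do {
                 P \<leftarrow> add_elem N P;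
                 A \<leftarrow> add_elem N A;
                 return (P, A) }
               else return (P, A) })
            (P, A) })
       (P, A);
     return A }"

text \<open>\<open>None\<close> is the answer \<open>\<bottom>\<close>.\<close>

definition FindSep ::
  "'a mixed_graph \<Rightarrow> 'a set \<Rightarrow> 'a set \<Rightarrow> 'a set \<Rightarrow> 'a set \<Rightarrow> ('o, 'a set option) comp" where
  "FindSep G X Y I R = do {
     XY \<leftarrow> union_set (nodes G) X Y;
     R' \<leftarrow> diff_set (nodes G) R XY;
     S \<leftarrow> union_set (nodes G) XY I;
     A \<leftarrow> Anteriors G S;
     Z \<leftarrow> inter_set (nodes G) A R';
     sep \<leftarrow> TestSep G X Y Z;
     return (if sep then Some Z else None) }"

lemma bind_comp_cong [fundef_cong]:
  assumes "c = c'" and "\<And>t x. Result t x \<in> c' \<Longrightarrow> f x = f' x"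
  shows "bind_comp c f = bind_comp c' f'"
  unfolding bind_comp_def using assms by (intro SUP_cong) (auto split: outcome.split)

lemma pick_Result: "Result t x \<in> pick S \<Longrightarrow> finite S \<and> x \<in> S"
  by (auto simp: pick_def split: if_splits)

lemma union_set_Result: "Result t C \<in> union_set V A B \<Longrightarrow> C = A \<union> B"
  by (auto simp: union_set_def bind_comp_def elapse_def return_def)

lemma diff_set_Result: "Result t C \<in> diff_set V A B \<Longrightarrow> C = A - B"
  by (auto simp: diff_set_def bind_comp_def elapse_def return_def)

text \<open>Each recursive call gets sets of its own: their creation is paid for by
  \<open>union_set\<close> and \<open>diff_set\<close>.\<close>

function ListSep ::
  "'a mixed_graph \<Rightarrow> 'a set \<Rightarrow> 'a set \<Rightarrow> 'a set \<Rightarrow> 'a set \<Rightarrow> ('a set, unit) comp" where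
  "ListSep G X Y I R = do {
     s \<leftarrow> FindSep G X Y I R;
     if s \<noteq> None then do {
       leaf \<leftarrow> equal_set (nodes G) I R;
       if leaf then print_set (nodes G) I
       else do {
         D \<leftarrow> diff_set (nodes G) R I;
         v \<leftarrow> pick D;
         I' \<leftarrow> union_set (nodes G) I {v};
         R' \<leftarrow> diff_set (nodes G) R {v};
         ListSep G X Y I' R;
         ListSep G X Y I R' } }
     else return () }"
  by pat_completeness auto
termination
  by (relation "measure (\<lambda>(G, X, Y, I, R). card (R - I))")
    (auto dest!: pick_Result union_set_Result diff_set_Result intro!: psubset_card_mono)


section \<open>Enumeration with bounded delay\<close>

fun outputs :: "'o event list \<Rightarrow> 'o list" where
  "outputs [] = []"
| "outputs (Tick # t) = outputs t"
| "outputs (Output z # t) = z # outputs t"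

text \<open>The lengths of the periods into which the outputs divide a run; \<open>k\<close> is the time elapsed
  since the last output (or the start). The last period ends when the run ends.\<close>

fun delays :: "nat \<Rightarrow> 'o event list \<Rightarrow> nat list" where
  "delays k [] = [k]"
| "delays k (Tick # t) = delays (Suc k) t"
| "delays k (Output z # t) = k # delays 0 t"

text \<open>Every run stops, outputs each element of \<open>S\<close> exactly once and nothing else, and has delay
  at most \<open>d\<close>.\<close>

definition enumerates_with_delay :: "('o, unit) comp \<Rightarrow> 'o set \<Rightarrow> nat \<Rightarrow> bool" where
  "enumerates_with_delay c S d \<longleftrightarrow>
     c \<noteq> {} \<and>
     (\<forall>r\<in>c. \<exists>t. r = Result t () \<and> distinct (outputs t) \<and> set (outputs t) = S \<and>
        (\<forall>k \<in> set (delays 0 t). k \<le> d))"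

end

theory Submission
  imports Defs
begin

text \<open>
  Walks, in which nodes may recur, replace paths. In an ancestral graph a repeated node of a walk can be
  cut out: if it becomes a collider without having been one, the arrowhead at its first visit forces the
  walk to follow directed edges until it meets a collider, of which the node is then an ancestor. So
  \<open>TestSep\<close>, which searches for a walk, decides \<open>m\<close>-separation.

  If some \<open>Z'\<close> with \<open>I \<subseteq> Z' \<subseteq> R\<close> is a separator, so is \<open>Z = Ant (X \<union> Y \<union> I) \<inter> R\<close>: all nodes of a walk
  that connects given \<open>Z\<close> are anterior to \<open>X \<union> Y \<union> I\<close>, hence its non-colliders lie outside \<open>R\<close> and do
  not block it given \<open>Z'\<close>. A collider not in \<open>An Z'\<close> has a directed path that avoids \<open>Z'\<close> to \<open>X\<close> or
  \<open>Y\<close>, which serves as a new beginning or end of the walk.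

  Thus \<open>FindSep\<close> decides in time \<open>O(n + m)\<close> whether a call of \<open>ListSep\<close> has any solution, and each call
  that passes this test leads to an output. Since the recursion has depth at most \<open>n\<close> and a failing call
  has no further calls, only \<open>O(n)\<close> calls are made between two outputs.
\<close>

section \<open>Paths and anteriors\<close>

lemma edge_nodes:
  assumes "mixed_graph G" "edge G A f B"
  shows "A \<in> nodes G" "B \<in> nodes G"
proof -
  have *: "A \<in> nodes G \<and> B \<in> nodes G"
    if "{A, B} \<in> E" "E \<subseteq> {{a, b} | a b. a \<in> nodes G \<and> b \<in> nodes G \<and> a \<noteq> b}" for E
    using subsetD[OF that(2,1)] by (auto simp: doubleton_eq_iff)
  have "A \<in> nodes G \<and> B \<in> nodes G"
  proof (cases f)
    case Undirected
    then show ?thesis using assms *[of "undirected G"] by (simp add: mixed_graph_def)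
  next
    case Bidirected
    then show ?thesis using assms *[of "bidirected G"] by (simp add: mixed_graph_def)
  qed (use assms in \<open>auto simp: mixed_graph_def\<close>)
  then show "A \<in> nodes G" "B \<in> nodes G" by blast+
qed

fun reverse :: "edge_type \<Rightarrow> edge_type" where
  "reverse Forward = Backward"
| "reverse Backward = Forward"
| "reverse e = e"

lemma edge_reverse: "edge G B (reverse f) A \<longleftrightarrow> edge G A f B"
  by (cases f) (auto simp: insert_commute)

text \<open>Distinctness costs nothing: if the next node already occurs, the path is cut there. The
  parameter \<open>F\<close> serves ancestors and anteriors alike.\<close>

lemma path_by_edge_types_iff:
  assumes G: "mixed_graph G"
  shows "(\<exists>ps es. path G ps es \<and> hd ps = U \<and> last ps = W \<and> set es \<subseteq> F) \<longleftrightarrow>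
    U \<in> nodes G \<and> (U, W) \<in> {(A, B). \<exists>f\<in>F. edge G A f B}\<^sup>*" (is "?L \<longleftrightarrow> ?R")
proof
  assume ?L
  then obtain ps es where p: "path G ps es" "hd ps = U" "last ps = W" "set es \<subseteq> F" by blast
  have *: "(ps ! 0, ps ! k) \<in> {(A, B). \<exists>f\<in>F. edge G A f B}\<^sup>*" if "k \<le> length es" for k
    using that
  proof (induction k)
    case (Suc k)
    then have "edge G (ps ! k) (es ! k) (ps ! Suc k)" "es ! k \<in> F"
      using p by (auto simp: path_def)
    then show ?case using Suc by (auto intro: rtrancl.rtrancl_into_rtrancl)
  qed simp
  have ps: "ps \<noteq> []" "set ps \<subseteq> nodes G" "length ps - 1 = length es"
    using p by (auto simp: path_def)
  then have "ps ! 0 = U" "ps ! length es = W" using p by (simp_all add: hd_conv_nth last_conv_nth)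
  then show ?R using *[of "length es"] ps(1,2) p(2) hd_in_set[of ps] by auto
next
  assume ?R
  then have U: "U \<in> nodes G" and "(U, W) \<in> {(A, B). \<exists>f\<in>F. edge G A f B}\<^sup>*" by auto
  from this(2) show ?L
  proof (induction rule: rtrancl_induct)
    case base
    show ?case by (intro exI[of _ "[U]"] exI[of _ "[]"]) (simp add: path_def U)
  next
    case (step A B)
    then obtain ps es where p: "path G ps es" "hd ps = U" "last ps = A" "set es \<subseteq> F" by blast
    from step obtain f where f: "f \<in> F" "edge G A f B" by auto
    show ?case
    proof (cases "B \<in> set ps")
      case True
      then obtain i where i: "i < length ps" "ps ! i = B" by (auto simp: in_set_conv_nth)
      have "path G (take (Suc i) ps) (take i es)"
        using p(1) i by (auto simp: path_def dest: in_set_takeD)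
      moreover have "hd (take (Suc i) ps) = U" using p by simp
      moreover have "last (take (Suc i) ps) = B" using i by (simp add: take_Suc_conv_app_nth)
      moreover have "set (take i es) \<subseteq> F" using p by (auto dest: in_set_takeD)
      ultimately show ?thesis by blast
    next
      case False
      have "ps \<noteq> []" using p(1) by (auto simp: path_def)
      then have l: "ps ! length es = A" using p by (simp add: last_conv_nth path_def)
      have "path G (ps @ [B]) (es @ [f])"
        using p(1) False f(2) edge_nodes[OF G f(2)] l
        by (auto simp: path_def nth_append less_Suc_eq)
      moreover have "hd (ps @ [B]) = U" using p \<open>ps \<noteq> []\<close> by simp
      ultimately show ?thesis using p f by (intro exI[of _ "ps @ [B]"] exI[of _ "es @ [f]"]) auto
    qed
  qed
qed

lemma ancestor_iff:
  assumes "mixed_graph G"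
  shows "ancestor G U W \<longleftrightarrow> U \<in> nodes G \<and> (U, W) \<in> (directed G)\<^sup>*"
  using path_by_edge_types_iff[OF assms, of U W "{Forward}"] by (simp add: ancestor_def)

definition Ant :: "'a mixed_graph \<Rightarrow> 'a set \<Rightarrow> 'a set" where
  "Ant G S = {U. \<exists>W\<in>S. anterior G U W}"

lemma anterior_iff:
  assumes "mixed_graph G"
  shows "anterior G U W \<longleftrightarrow>
    U \<in> nodes G \<and> (U, W) \<in> {(A, B). edge G A Forward B \<or> edge G A Undirected B}\<^sup>*"
  using path_by_edge_types_iff[OF assms, of U W "{Forward, Undirected}"]
  by (simp add: anterior_def)

lemma Ant_nodes: "mixed_graph G \<Longrightarrow> Ant G S \<subseteq> nodes G"
  by (auto simp: Ant_def anterior_iff)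

lemma An_self: "mixed_graph G \<Longrightarrow> A \<in> S \<Longrightarrow> A \<in> nodes G \<Longrightarrow> A \<in> An G S"
  by (auto simp: An_def ancestor_iff)

lemma Ant_self: "mixed_graph G \<Longrightarrow> A \<in> S \<Longrightarrow> A \<in> nodes G \<Longrightarrow> A \<in> Ant G S"
  by (auto simp: Ant_def anterior_iff)

lemma An_step:
  assumes "mixed_graph G" "edge G A Forward B" "B \<in> An G S"
  shows "A \<in> An G S"
  using assms edge_nodes(1)[OF assms(1,2)]
  by (auto simp: An_def ancestor_iff intro: converse_rtrancl_into_rtrancl)

lemma Ant_step:
  assumes "mixed_graph G" "edge G A f B" "\<not> arrowhead_at_source f" "B \<in> Ant G S"
  shows "A \<in> Ant G S"
proof -
  have "f = Forward \<or> f = Undirected"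
    using assms(3) by (cases f) (auto simp: arrowhead_at_source_def)
  then show ?thesis using assms(2,4) edge_nodes(1)[OF assms(1,2)]
    unfolding Ant_def anterior_iff[OF assms(1)]
    by (blast intro: converse_rtrancl_into_rtrancl)
qed

lemma An_subset_Ant:
  assumes G: "mixed_graph G" and S: "S \<subseteq> Ant G S'"
  shows "An G S \<subseteq> Ant G S'"
proof
  fix A assume "A \<in> An G S"
  then obtain W where W: "W \<in> S" "(A, W) \<in> (directed G)\<^sup>*" by (auto simp: An_def ancestor_iff[OF G])
  from W(2) show "A \<in> Ant G S'"
  proof (induction rule: converse_rtrancl_induct)
    case (step A B)
    then show ?case using Ant_step[OF G, of A Forward B] by (simp add: arrowhead_at_source_def)
  qed (use W S in auto)
qed

lemma no_undirected_at_arrowhead: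
  assumes "ancestral_graph G" "edge G A f B" "arrowhead_at_source f" "edge G A g C"
  shows "g \<noteq> Undirected"
  using assms by (auto simp: ancestral_graph_def arrowhead_at_source_def simp del: edge.simps)

lemma arrowhead_reverse:
  "arrowhead_at_source (reverse f) = arrowhead_at_target f"
  "arrowhead_at_target (reverse f) = arrowhead_at_source f"
  by (cases f; simp add: arrowhead_at_source_def arrowhead_at_target_def)+

lemma not_undirected_after_arrowhead:
  assumes "ancestral_graph G" "edge G A e B" "arrowhead_at_target e" "edge G B f C"
  shows "f \<noteq> Undirected"
  using no_undirected_at_arrowhead[OF assms(1), of B "reverse e" A f C] assms
  by (simp add: edge_reverse arrowhead_reverse)

text \<open>An arrowhead at \<open>A\<close> excludes undirected edges at \<open>A\<close>, so an
  anterior path starts with a directed edge, whose arrowhead does the same at the next node. By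
  induction the whole path is directed.\<close>

lemma Ant_arrowhead_imp_An:
  assumes G: "ancestral_graph G" and "edge G C e A" "arrowhead_at_target e" "A \<in> Ant G S"
  shows "A \<in> An G S"
proof -
  have mG: "mixed_graph G" using G by (simp add: ancestral_graph_def)
  obtain W where W: "W \<in> S" "(A, W) \<in> {(A, B). edge G A Forward B \<or> edge G A Undirected B}\<^sup>*"
    using assms(4) by (auto simp: Ant_def anterior_iff[OF mG])
  from W(2) assms(2,3) have "A \<in> nodes G \<longrightarrow> A \<in> An G S"
  proof (induction arbitrary: C e rule: converse_rtrancl_induct)
    case base
    then show ?case using W An_self[OF mG] by blast
  next
    case (step A B)
    then have AB: "edge G A Forward B"
      using not_undirected_after_arrowhead[OF G, of C e A Undirected B] by auto
    then have "B \<in> An G S"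
      using step.IH[OF AB] edge_nodes[OF mG AB] by (simp add: arrowhead_at_target_def)
    then show ?case using An_step[OF mG AB] by simp
  qed
  then show ?thesis using assms(4) Ant_nodes[OF mG] by blast
qed

section \<open>Walks and m-separation\<close>

text \<open>A state \<open>(e, T)\<close> is a node \<open>T\<close> with the edge \<open>e\<close> through which it was entered. The choice
  \<open>C = An G Z\<close>, \<open>D = Z\<close> gives the condition of \<open>m_connected\<close>; \<open>C = D = Z\<close> gives the transitions of
  \<open>TestSep\<close>. As \<open>Backward\<close> has no arrowhead at its target, \<open>(Backward, U)\<close> serves as initial state.\<close>

definition m_step ::
  "'a mixed_graph \<Rightarrow> 'a set \<Rightarrow> 'a set \<Rightarrow> ((edge_type \<times> 'a) \<times> (edge_type \<times> 'a)) set" where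
  "m_step G C D = {((e, T), (f, N)). edge G T f N \<and>
     (if arrowhead_at_target e \<and> arrowhead_at_source f then T \<in> C else T \<notin> D)}"

lemma m_step_iff: "((e, T), (f, N)) \<in> m_step G C D \<longleftrightarrow> edge G T f N \<and>
     (if arrowhead_at_target e \<and> arrowhead_at_source f then T \<in> C else T \<notin> D)"
  by (simp add: m_step_def)

lemma m_step_nodes: "mixed_graph G \<Longrightarrow> (s, t) \<in> m_step G C D \<Longrightarrow> snd t \<in> nodes G"
  by (cases s; cases t) (auto simp: m_step_iff dest: edge_nodes)

lemma m_connected_imp_walk:
  assumes G: "mixed_graph G" and "m_connected G Z U W"
  shows "U \<in> nodes G \<and> U \<notin> Z \<and> W \<notin> Z \<and> (\<exists>e. ((Backward, U), (e, W)) \<in> (m_step G (An G Z) Z)\<^sup>*)"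
proof -
  obtain ps es where p: "path G ps es" "hd ps = U" "last ps = W"
    and c: "\<And>i. i < length ps \<Longrightarrow> if collider es i then ps ! i \<in> An G Z else ps ! i \<notin> Z"
    using assms(2) by (auto simp: m_connected_def)
  have ne: "ps \<noteq> []" and len: "length ps = Suc (length es)" using p by (auto simp: path_def)
  have U: "U = ps ! 0" using p ne by (simp add: hd_conv_nth)
  have W: "W = ps ! length es" using p ne len by (simp add: last_conv_nth)
  \<comment> \<open>Prepending \<open>Backward\<close> makes entry \<open>k\<close> the edge by
    which \<open>ps ! k\<close> is entered; the first node thus gets no arrowhead.\<close>
  have *: "((Backward, U), ((Backward # es) ! k, ps ! k)) \<in> (m_step G (An G Z) Z)\<^sup>*"
    if "k \<le> length es" for k
    using that
  proof (induction k)
    case (Suc k)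
    then have "edge G (ps ! k) (es ! k) (ps ! Suc k)" using p by (auto simp: path_def)
    moreover have "collider es k \<longleftrightarrow>
        arrowhead_at_target ((Backward # es) ! k) \<and> arrowhead_at_source (es ! k)"
      using Suc by (cases k) (auto simp: collider_def arrowhead_at_target_def)
    ultimately have "(((Backward # es) ! k, ps ! k), (es ! k, ps ! Suc k)) \<in> m_step G (An G Z) Z"
      using c[of k] Suc.prems len by (simp add: m_step_iff)
    then show ?case using Suc by (auto intro: rtrancl.rtrancl_into_rtrancl)
  qed (simp add: U)
  from *[of "length es"] c[of 0] c[of "length es"] show ?thesis
    using U W len p ne by (auto simp: collider_def path_def)
qed

text \<open>The arrowhead at the first node is pushed forward along the list until a collider stops it.\<close>

lemma An_of_arrowhead_to_tail:
  assumes G: "ancestral_graph G"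
  shows "successively (\<lambda>s t. (s, t) \<in> m_step G (An G Z) D) ((e, T) # vs) \<Longrightarrow>
    edge G C e T \<Longrightarrow> arrowhead_at_target e \<Longrightarrow> vs \<noteq> [] \<Longrightarrow>
    \<not> arrowhead_at_target (fst (last vs)) \<Longrightarrow> T \<in> An G Z"
proof (induction vs arbitrary: e T C)
  case (Cons v vs)
  obtain f N where v: "v = (f, N)" by fastforce
  have s: "edge G T f N" "arrowhead_at_source f \<Longrightarrow> T \<in> An G Z"
    using Cons.prems by (auto simp: v m_step_iff)
  show ?case
  proof (cases "arrowhead_at_source f")
    case False
    then have f: "f = Forward"
      using not_undirected_after_arrowhead[OF G Cons.prems(2,3) s(1)]
      by (cases f) (auto simp: arrowhead_at_source_def)
    \<comment> \<open>As the last edge, \<open>f\<close> would contradict the assumption on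
      \<open>last vs\<close>.\<close>
    then have "vs \<noteq> []" using Cons.prems(5) by (auto simp: v arrowhead_at_target_def)
    then have "N \<in> An G Z"
      using Cons.IH[of f N T] Cons.prems s(1) f by (simp add: v arrowhead_at_target_def)
    then show ?thesis using An_step[of G T N] s(1) f G by (simp add: ancestral_graph_def)
  qed (use s in simp)
qed simp

text \<open>A repeated node is cut out as soon as it occurs. The last edge of the resulting list may differ
  from the last edge of the walk, but only where this does not affect how the list can be
  continued.\<close>

lemma walk_imp_distinct_walk:
  assumes G: "ancestral_graph G" and U: "U \<notin> Z"
    and "((Backward, U), (f, N)) \<in> (m_step G (An G Z) Z)\<^sup>*"
  shows "\<exists>ss e. successively (\<lambda>s t. (s, t) \<in> m_step G (An G Z) Z) ss \<and> distinct (map snd ss) \<and>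
    ss \<noteq> [] \<and> hd ss = (Backward, U) \<and> last ss = (e, N) \<and>
    (\<not> arrowhead_at_target e \<and> arrowhead_at_target f \<longrightarrow> N \<notin> Z) \<and>
    (arrowhead_at_target e \<and> \<not> arrowhead_at_target f \<longrightarrow> N \<in> An G Z)"
  using assms(3)
proof (induction "(f, N)" arbitrary: f N rule: rtrancl_induct)
  case base
  show ?case by (intro exI[of _ "[(Backward, U)]"]) simp
next
  case (step s g M)
  obtain f N where s: "s = (f, N)" by fastforce
  let ?r = "\<lambda>s t. (s, t) \<in> m_step G (An G Z) Z"
  obtain ss e where ss: "successively ?r ss" "distinct (map snd ss)" "ss \<noteq> []"
      "hd ss = (Backward, U)" "last ss = (e, N)"
    and e: "\<not> arrowhead_at_target e \<Longrightarrow> arrowhead_at_target f \<Longrightarrow> N \<notin> Z"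
      "arrowhead_at_target e \<Longrightarrow> \<not> arrowhead_at_target f \<Longrightarrow> N \<in> An G Z"
    using step.hyps(3)[OF s] by blast
  have NM: "((f, N), (g, M)) \<in> m_step G (An G Z) Z" using step s by simp
  \<comment> \<open>The facts \<open>e\<close> cover the two cases in which the edges
    \<open>e\<close> and \<open>f\<close> differ in having an arrowhead at \<open>N\<close>.\<close>
  then have "?r (e, N) (g, M)" using e by (auto simp: m_step_iff split: if_splits)
  then have ext: "successively ?r (ss @ [(g, M)])"
    using ss by (simp add: successively_append_iff)
  show ?case
  proof (cases "M \<in> set (map snd ss)")
    case False
    then show ?thesis using ext ss by (intro exI[of _ "ss @ [(g, M)]"] exI[of _ g]) auto
  next
    case True
    then obtain e' where "(e', M) \<in> set ss" by auto
    then obtain us vs where split: "ss = us @ (e', M) # vs" by (auto dest: split_list)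
    have ext': "successively ?r ((e', M) # vs @ [(g, M)])"
      using ext by (auto simp: split successively_append_iff)
    have "M \<notin> Z" if a: "\<not> arrowhead_at_target e'"
    proof (cases us)
      case Nil
      then show ?thesis using ss(4) U by (simp add: split)
    next
      case (Cons u us')
      obtain h L where "hd (vs @ [(g, M)]) = (h, L)" by fastforce
      then have "?r (e', M) (h, L)" using ext' by (cases vs) auto
      then show ?thesis using a by (simp add: m_step_iff)
    qed
    \<comment> \<open>The start has no arrowhead, so \<open>e'\<close> belongs to an actual edge
      into \<open>M\<close>. The walk from there back to \<open>M\<close> ends without an arrowhead,
      as \<open>An_of_arrowhead_to_tail\<close> requires.\<close>
    moreover have "M \<in> An G Z" if a: "arrowhead_at_target e'" and g: "\<not> arrowhead_at_target g"
    proof -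
      have "us \<noteq> []" using ss(4) a by (auto simp: split arrowhead_at_target_def)
      then have "?r (last us) (e', M)" using ss(1) by (auto simp: split successively_append_iff)
      then obtain L where "edge G L e' M" by (cases "last us") (auto simp: m_step_iff)
      then show ?thesis using An_of_arrowhead_to_tail[OF G ext' _ a] g by simp
    qed
    ultimately show ?thesis using ss
      by (intro exI[of _ "us @ [(e', M)]"] exI[of _ e'])
        (auto simp: split successively_append_iff hd_append split: if_splits)
  qed
qed

lemma walk_imp_m_connected:
  assumes G: "ancestral_graph G" and U: "U \<in> nodes G" "U \<notin> Z" and W: "W \<notin> Z"
    and w: "((Backward, U), (f, W)) \<in> (m_step G (An G Z) Z)\<^sup>*"
  shows "m_connected G Z U W"
proof -
  have mG: "mixed_graph G" using G by (simp add: ancestral_graph_def)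
  let ?r = "\<lambda>s t. (s, t) \<in> m_step G (An G Z) Z"
  obtain ss e where ss: "successively ?r ss" "distinct (map snd ss)" "ss \<noteq> []"
      "hd ss = (Backward, U)" "last ss = (e, W)"
    using walk_imp_distinct_walk[OF G U(2) w] by blast
  obtain rest where rest: "ss = (Backward, U) # rest" using ss(3,4) by (cases ss) auto
  have st: "((fst (ss ! i), snd (ss ! i)), (fst (rest ! i), snd (rest ! i))) \<in> m_step G (An G Z) Z"
    if "i < length rest" for i
    using ss(1) that by (auto simp: successively_conv_nth rest)
  have "snd v \<in> nodes G" if "v \<in> set rest" for v
    using that m_step_nodes[OF mG st] by (auto simp: in_set_conv_nth)
  then have nodes: "snd ` set ss \<subseteq> nodes G" using U(1) by (auto simp: rest)
  have "edge G (map snd ss ! i) (map fst rest ! i) (map snd ss ! Suc i)" if "i < length rest" for i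
    using that st[OF that, unfolded m_step_iff] rest nth_map[of i ss snd] by simp
  then have "path G (map snd ss) (map fst rest)"
    using ss(2) nodes by (simp add: path_def) (simp add: rest)
  moreover have "hd (map snd ss) = U" "last (map snd ss) = W"
    using ss by (auto simp: hd_map last_map)
  moreover have "if collider (map fst rest) i then map snd ss ! i \<in> An G Z else map snd ss ! i \<notin> Z"
    if i: "i < length (map snd ss)" for i
  proof (cases "i < length rest")
    case True
    have "collider (map fst rest) i \<longleftrightarrow>
        arrowhead_at_target (fst (ss ! i)) \<and> arrowhead_at_source (fst (rest ! i))"
      using True by (cases i) (auto simp: collider_def rest arrowhead_at_target_def)
    then show ?thesis using st[OF True, unfolded m_step_iff] i by auto
  next
    case False
    then have "i = length ss - 1" using i rest by auto
    then have "snd (ss ! i) = W" using ss(3,5) by (simp add: last_conv_nth)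
    then show ?thesis using False W i by (simp add: collider_def)
  qed
  ultimately show ?thesis unfolding m_connected_def by blast
qed

lemma m_connected_iff_walk:
  assumes "ancestral_graph G"
  shows "m_connected G Z U W \<longleftrightarrow> U \<in> nodes G \<and> U \<notin> Z \<and> W \<notin> Z \<and>
    (\<exists>e. ((Backward, U), (e, W)) \<in> (m_step G (An G Z) Z)\<^sup>*)"
  using m_connected_imp_walk[of G Z U W] walk_imp_m_connected[OF assms] assms
  by (auto simp: ancestral_graph_def)

text \<open>A collider with a descendant in \<open>Z\<close> is replaced by the detour to that descendant and back.\<close>

lemma detour_to_collider:
  assumes "(T, W) \<in> (directed G)\<^sup>*" "W \<in> Z" "T \<notin> Z"
  shows "((e, T), (Backward, T)) \<in> (m_step G Z Z)\<^sup>*"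
  using assms(1,3)
proof (induction arbitrary: e rule: converse_rtrancl_induct)
  case (step A B)
  have 1: "((e, A), (Forward, B)) \<in> m_step G Z Z"
    using step by (simp add: m_step_iff arrowhead_at_source_def)
  have 2: "((Backward, B), (Backward, A)) \<in> m_step G Z Z" if "B \<notin> Z"
    using step that by (simp add: m_step_iff arrowhead_at_target_def)
  \<comment> \<open>The detour turns round at the first node in \<open>Z\<close>, which is then a
    collider.\<close>
  have 3: "((Forward, B), (Backward, A)) \<in> m_step G Z Z" if "B \<in> Z"
    using step that by (simp add: m_step_iff arrowhead_at_target_def arrowhead_at_source_def)
  show ?case
  proof (cases "B \<in> Z")
    case True
    then show ?thesis using 1 3 by (meson r_into_rtrancl rtrancl.rtrancl_into_rtrancl)
  next
    case False
    have "((Forward, B), (Backward, B)) \<in> (m_step G Z Z)\<^sup>*" using step.IH False by blast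
    then show ?thesis using 1 2[OF False]
      by (meson converse_rtrancl_into_rtrancl rtrancl.rtrancl_into_rtrancl)
  qed
qed (use assms(2) in simp)

text \<open>The relations differ only at colliders in \<open>An G Z\<close> outside
  \<open>Z\<close>. The detour comes back to such a node through a tail, so that it can be left as a
  non-collider.\<close>

lemma m_step_An_rtrancl:
  assumes G: "mixed_graph G"
  shows "(m_step G (An G Z) Z)\<^sup>* = (m_step G Z Z)\<^sup>*"
proof (rule rtrancl_subset)
  show "m_step G Z Z \<subseteq> m_step G (An G Z) Z"
    using An_self[OF G] edge_nodes(1)[OF G] by (auto simp: m_step_def split: if_splits)
  show "m_step G (An G Z) Z \<subseteq> (m_step G Z Z)\<^sup>*"
  proof (rule subrelI)
    fix s t assume st': "(s, t) \<in> m_step G (An G Z) Z"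
    obtain e T f N where s: "s = (e, T)" and t: "t = (f, N)" by fastforce
    note st = st'[unfolded s t]
    show "(s, t) \<in> (m_step G Z Z)\<^sup>*"
    proof (cases "T \<in> An G Z \<and> T \<notin> Z")
      case True
      then obtain W where W: "(T, W) \<in> (directed G)\<^sup>*" "W \<in> Z"
        by (auto simp: An_def ancestor_iff[OF G])
      have "((e, T), (Backward, T)) \<in> (m_step G Z Z)\<^sup>*"
        using detour_to_collider[OF W] True by simp
      moreover have "((Backward, T), (f, N)) \<in> m_step G Z Z"
        using st True by (simp add: m_step_iff arrowhead_at_target_def)
      ultimately show ?thesis unfolding s t by (rule rtrancl.rtrancl_into_rtrancl)
    next
      case False
      then have "((e, T), (f, N)) \<in> m_step G Z Z" using st by (auto simp: m_step_iff split: if_splits)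
      then show ?thesis unfolding s t by blast
    qed
  qed
qed

text \<open>Links \<open>m\<close>-separation to the reachability question that
  \<open>TestSep\<close> answers. Reachability alone does not keep the endpoints of a walk out of
  \<open>Z\<close>; the disjointness assumptions do.\<close>

lemma m_separator_iff_walk:
  assumes G: "ancestral_graph G" and X: "X \<subseteq> nodes G" "X \<inter> Z = {}" and Y: "Y \<inter> Z = {}"
  shows "m_separator G X Y Z \<longleftrightarrow>
    \<not> (\<exists>x\<in>X. \<exists>e. \<exists>y\<in>Y. ((Backward, x), (e, y)) \<in> (m_step G Z Z)\<^sup>*)"
proof -
  have mG: "mixed_graph G" using G by (simp add: ancestral_graph_def)
  show ?thesis
    using X Y unfolding m_separator_def m_connected_iff_walk[OF G] m_step_An_rtrancl[OF mG] by blast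
qed

section \<open>Reducing the search for a separator to one candidate\<close>

text \<open>As \<open>A\<close> is not in \<open>An G D\<close>, the edges of a directed path from
  \<open>A\<close> to \<open>B\<close> join nodes outside \<open>D\<close>. No node acts as a
  collider in either direction, hence \<open>C\<close> is arbitrary. Forwards this gives a new end
  of a walk, backwards a new beginning.\<close>

lemma walk_along_directed:
  assumes "(A, B) \<in> (directed G)\<^sup>*" "mixed_graph G" "A \<notin> An G D"
  shows "\<exists>e'. ((e, A), (e', B)) \<in> (m_step G C D)\<^sup>*"
    and "((Backward, B), (Backward, A)) \<in> (m_step G C D)\<^sup>*"
proof -
  have "(\<forall>e. \<exists>e'. ((e, A), (e', B)) \<in> (m_step G C D)\<^sup>*) \<and>
    ((Backward, B), (Backward, A)) \<in> (m_step G C D)\<^sup>*"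
    using assms(1,3)
  proof (induction rule: converse_rtrancl_induct)
    case (step A A')
    then have AA': "edge G A Forward A'" by simp
    have n: "A' \<notin> An G D" "A \<notin> D" "A' \<notin> D"
      using An_step[OF assms(2) AA'] An_self[OF assms(2)] edge_nodes[OF assms(2) AA'] step.prems
      by blast+
    have "((e, A), (Forward, A')) \<in> m_step G C D" for e
      using AA' n by (simp add: m_step_iff arrowhead_at_source_def)
    moreover have "((Backward, A'), (Backward, A)) \<in> m_step G C D"
      using AA' n by (simp add: m_step_iff arrowhead_at_target_def)
    ultimately show ?case using step.IH[OF n(1)]
      by (meson converse_rtrancl_into_rtrancl rtrancl.rtrancl_into_rtrancl)
  qed blast
  then show "\<exists>e'. ((e, A), (e', B)) \<in> (m_step G C D)\<^sup>*"
    and "((Backward, B), (Backward, A)) \<in> (m_step G C D)\<^sup>*" by blast+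
qed

text \<open>A node left by a tail is anterior to the next node if that one is anterior to
  \<open>S\<close>. A node left through an arrowhead has no undirected edge, so the tail-first edge
  into it has an arrowhead there too: it is a collider and lies in \<open>C\<close>. Otherwise the
  walk ends at \<open>W\<close>.\<close>

lemma tail_before_walk_imp_Ant:
  assumes G: "ancestral_graph G" and C: "C \<subseteq> Ant G S" and W: "W \<in> Ant G S"
    and "((f, N), (g, W)) \<in> (m_step G C D)\<^sup>*" "edge G T f N" "\<not> arrowhead_at_source f"
  shows "T \<in> Ant G S"
  using assms(4-6)
proof (induction arbitrary: T rule: converse_rtrancl_induct2)
  case refl
  then show ?case using Ant_step W G by (auto simp: ancestral_graph_def)
next
  case (step f N h M)
  have mG: "mixed_graph G" using G by (simp add: ancestral_graph_def)
  have NM: "edge G N h M" and N: "arrowhead_at_target f \<Longrightarrow> arrowhead_at_source h \<Longrightarrow> N \<in> Ant G S"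
    using step.hyps(1) C by (auto simp: m_step_iff split: if_splits)
  have "N \<in> Ant G S"
  proof (cases "arrowhead_at_source h")
    case True
    have "edge G N (reverse f) T" using step.prems by (simp add: edge_reverse)
    then have "reverse f \<noteq> Undirected" using no_undirected_at_arrowhead[OF G NM True] by blast
    then have "arrowhead_at_target f"
      using step.prems by (cases f) (auto simp: arrowhead_at_target_def arrowhead_at_source_def)
    then show ?thesis using N True by blast
  qed (use step.IH NM in blast)
  then show ?case using Ant_step[OF mG step.prems] by blast
qed

text \<open>Counterpart of \<open>tail_before_walk_imp_Ant\<close> for the walk up to
  \<open>T\<close>. In the arrowhead case the existence of the entering edge is recorded, in order
  to exclude undirected edges at \<open>T\<close>. The start falls under the tail case.\<close>

lemma tail_after_walk_imp_Ant:
  assumes G: "ancestral_graph G" and C: "C \<subseteq> Ant G S" and U: "U \<in> Ant G S"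
    and "((Backward, U), (e, T)) \<in> (m_step G C D)\<^sup>*"
  shows "if arrowhead_at_target e then \<exists>L. edge G L e T else T \<in> Ant G S"
  using assms(4)
proof (induction rule: rtrancl_induct2)
  case refl
  then show ?case using U by (simp add: arrowhead_at_target_def)
next
  case (step f N g M)
  have mG: "mixed_graph G" using G by (simp add: ancestral_graph_def)
  have NM: "edge G N g M" and N: "arrowhead_at_target f \<Longrightarrow> arrowhead_at_source g \<Longrightarrow> N \<in> Ant G S"
    using step.hyps(2) C by (auto simp: m_step_iff split: if_splits)
  show ?case
  proof (cases "arrowhead_at_target g")
    case False
    have "N \<in> Ant G S"
    proof (cases "arrowhead_at_target f")
      case True
      then obtain L where "edge G L f N" using step.IH by auto
      then have "g \<noteq> Undirected" using not_undirected_after_arrowhead[OF G _ True NM] by blast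
      then have "arrowhead_at_source g"
        using False by (cases g) (auto simp: arrowhead_at_target_def arrowhead_at_source_def)
      then show ?thesis using N True by blast
    qed (use step.IH in simp)
    then have "M \<in> Ant G S"
      using Ant_step[OF mG, of M "reverse g" N S] NM False by (simp add: edge_reverse arrowhead_reverse)
    then show ?thesis using False by simp
  qed (use NM in auto)
qed

text \<open>A walk that connects given the candidate is converted, step by step, into one that
  connects given \<open>Z'\<close>.\<close>

lemma m_separator_Ant_Int:
  assumes G: "ancestral_graph G"
    and X: "X \<subseteq> nodes G" "X \<inter> R = {}" and Y: "Y \<subseteq> nodes G" "Y \<inter> R = {}" and R: "R \<subseteq> nodes G"
    and Z': "I \<subseteq> Z'" "Z' \<subseteq> R" "m_separator G X Y Z'"
  shows "m_separator G X Y (Ant G (X \<union> Y \<union> I) \<inter> R)"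
proof (rule ccontr)
  have mG: "mixed_graph G" using G by (simp add: ancestral_graph_def)
  define S where "S = X \<union> Y \<union> I"
  define Z where "Z = Ant G S \<inter> R"
  assume "\<not> m_separator G X Y (Ant G (X \<union> Y \<union> I) \<inter> R)"
  then obtain U W g where UW: "U \<in> X" "W \<in> Y"
    and w: "((Backward, U), (g, W)) \<in> (m_step G (An G Z) Z)\<^sup>*"
    by (auto simp: m_separator_def m_connected_iff_walk[OF G] Z_def S_def)
  have AnZ: "An G Z \<subseteq> Ant G S" by (rule An_subset_Ant[OF mG]) (auto simp: Z_def)
  have U: "U \<in> Ant G S" and W: "W \<in> Ant G S"
    using UW X Y by (auto simp: S_def intro!: Ant_self[OF mG])
  have on_walk: "((e, T), (f, N)) \<in> m_step G (An G S) Z'"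
    if pre: "((Backward, U), (e, T)) \<in> (m_step G (An G Z) Z)\<^sup>*"
      and st: "((e, T), (f, N)) \<in> m_step G (An G Z) Z"
      and suf: "((f, N), (g, W)) \<in> (m_step G (An G Z) Z)\<^sup>*" for e T f N
  proof -
    note T = tail_after_walk_imp_Ant[OF G AnZ U pre]
    have TN: "edge G T f N" using st by (simp add: m_step_iff)
    show ?thesis
    proof (cases "arrowhead_at_target e \<and> arrowhead_at_source f")
      case True
      then have "T \<in> Ant G S" using st AnZ by (auto simp: m_step_iff)
      then have "T \<in> An G S" using T True Ant_arrowhead_imp_An[OF G] by auto
      then show ?thesis using TN True by (simp add: m_step_iff)
    next
      case False
      then have "T \<in> Ant G S" using T tail_before_walk_imp_Ant[OF G AnZ W suf TN]
        by (auto split: if_splits)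
      moreover have "T \<notin> Z" using st False by (auto simp: m_step_iff split: if_splits)
      ultimately have "T \<notin> Z'" using Z' by (auto simp: Z_def)
      then show ?thesis using TN False unfolding m_step_iff by presburger
    qed
  qed
  let ?r = "(m_step G (An G Z') Z')\<^sup>*"
  have sep: "((Backward, x), (e, y)) \<notin> ?r" if "x \<in> X" "y \<in> Y" for x y e
    using Z'(2,3) X Y that unfolding m_separator_def m_connected_iff_walk[OF G] by blast
  \<comment> \<open>The start \<open>x\<close> is existential since a repair may replace the
    beginning of the walk; the premise on the rest of the walk makes \<open>on_walk\<close>
    applicable.\<close>
  have "((f, N), (g, W)) \<in> (m_step G (An G Z) Z)\<^sup>* \<longrightarrow> (\<exists>x\<in>X. ((Backward, x), (f, N)) \<in> ?r)"
    if "((Backward, U), (f, N)) \<in> (m_step G (An G Z) Z)\<^sup>*" for f N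
    using that
  proof (induction rule: rtrancl_induct2)
    case (step e T f N)
    show ?case
    proof
      assume suf: "((f, N), (g, W)) \<in> (m_step G (An G Z) Z)\<^sup>*"
      then obtain x where x: "x \<in> X" "((Backward, x), (e, T)) \<in> ?r"
        using step by (meson converse_rtrancl_into_rtrancl)
      have st: "((e, T), (f, N)) \<in> m_step G (An G S) Z'"
        using on_walk[OF step.hyps suf] .
      show "\<exists>x\<in>X. ((Backward, x), (f, N)) \<in> ?r"
      proof (cases "((e, T), (f, N)) \<in> m_step G (An G Z') Z'")
        case True
        then show ?thesis using x by (blast intro: rtrancl.rtrancl_into_rtrancl)
      next
        case False
        then have T: "T \<in> An G S" "T \<notin> An G Z'" and TN: "edge G T f N"
          using st by (auto simp: m_step_iff split: if_splits)
        then have "T \<notin> Z'" using An_self[OF mG] edge_nodes[OF mG TN] by blast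
        obtain B where B: "B \<in> S" "(T, B) \<in> (directed G)\<^sup>*"
          using T(1) by (auto simp: An_def ancestor_iff[OF mG])
        note dir = walk_along_directed[OF B(2) mG T(2)]
        \<comment> \<open>From \<open>X\<close>, a new beginning reaches \<open>T\<close> by a tail;
          with \<open>B\<close> in \<open>Y\<close>, a forbidden walk would be complete; with
          \<open>B\<close> in \<open>I\<close>, the node \<open>T\<close> would be in
          \<open>An G Z'\<close>.\<close>
        consider "B \<in> X" | "B \<in> Y" | "B \<in> I" using B by (auto simp: S_def)
        then show ?thesis
        proof cases
          case 1
          have "((Backward, T), (f, N)) \<in> m_step G (An G Z') Z'"
            using TN \<open>T \<notin> Z'\<close> by (simp add: m_step_iff arrowhead_at_target_def)
          then show ?thesis using 1 dir(2) by (blast intro: rtrancl.rtrancl_into_rtrancl)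
        next
          case 2
          obtain e' where "((e, T), (e', B)) \<in> ?r" using dir(1) by blast
          then have "((Backward, x), (e', B)) \<in> ?r" using x(2) by (meson rtrancl_trans)
          then show ?thesis using sep[OF x(1) 2] by blast
        next
          case 3
          then show ?thesis
            using T(2) B(2) Z'(1) edge_nodes(1)[OF mG TN] by (auto simp: An_def ancestor_iff[OF mG])
        qed
      qed
    qed
  qed (use UW in blast)
  then show False using w sep UW by blast
qed

section \<open>Reasoning about running times\<close>

text \<open>Total correctness over all choices: having no \<open>Fail\<close> covers divergence and
  stuck runs, and nonemptiness prevents vacuous truth.\<close>

definition runs :: "('o, 'a) comp \<Rightarrow> ('o event list \<Rightarrow> 'a \<Rightarrow> bool) \<Rightarrow> bool" where
  "runs c Q \<longleftrightarrow> c \<noteq> {} \<and> (\<forall>r\<in>c. \<exists>t x. r = Result t x \<and> Q t x)"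

text \<open>Without outputs a trace is determined by its length, so a number of ticks replaces
  it.\<close>

definition takes :: "('o, 'a) comp \<Rightarrow> (nat \<Rightarrow> 'a \<Rightarrow> bool) \<Rightarrow> bool" where
  "takes c Q \<longleftrightarrow> runs c (\<lambda>t x. \<exists>k. t = replicate k Tick \<and> Q k x)"

lemma takes_iff:
  "takes c Q \<longleftrightarrow> c \<noteq> {} \<and> (\<forall>r\<in>c. \<exists>k x. r = Result (replicate k Tick) x \<and> Q k x)"
  unfolding takes_def runs_def by blast

lemma runs_mono:
  "runs c P \<Longrightarrow> (\<And>t x. P t x \<Longrightarrow> Q t x) \<Longrightarrow> runs c Q"
  unfolding runs_def by blast

lemma runs_singleton [simp]: "runs {Result t x} Q \<longleftrightarrow> Q t x"
  by (simp add: runs_def)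

lemma runs_return [simp]: "runs (return x) Q \<longleftrightarrow> Q [] x"
  by (simp add: return_def)

lemma runs_bind:
  assumes "runs c (\<lambda>t x. runs (f x) (\<lambda>u. Q (t @ u)))"
  shows "runs (bind_comp c f) Q"
proof -
  have "\<exists>t y. r = Result t y \<and> Q t y" if r: "r \<in> bind_comp c f" for r
  proof -
    obtain q where q: "q \<in> c" "r \<in> (case q of Fail \<Rightarrow> {Fail} | Result t x \<Rightarrow> prepend t ` f x)"
      using r by (auto simp: bind_comp_def)
    obtain t x where t: "q = Result t x" "runs (f x) (\<lambda>u. Q (t @ u))"
      using assms q(1) unfolding runs_def by blast
    then obtain p where "p \<in> f x" "r = prepend t p" using q(2) by auto
    moreover then obtain u y where "p = Result u y" "Q (t @ u) y"
      using t(2) unfolding runs_def by blast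
    ultimately show ?thesis by auto
  qed
  moreover have "bind_comp c f \<noteq> {}"
  proof -
    obtain q where "q \<in> c" using assms by (auto simp: runs_def)
    moreover then obtain t x where "q = Result t x" "runs (f x) (\<lambda>u. Q (t @ u))"
      using assms unfolding runs_def by blast
    moreover then obtain p where "p \<in> f x" by (auto simp: runs_def)
    ultimately show ?thesis by (force simp: bind_comp_def)
  qed
  ultimately show ?thesis by (simp add: runs_def)
qed

lemma runs_bind_takes:
  assumes "takes c (\<lambda>k x. runs (f x) (\<lambda>u. Q (replicate k Tick @ u)))"
  shows "runs (bind_comp c f) Q"
  using assms unfolding takes_def by (blast intro: runs_bind runs_mono)

lemma takes_mono:
  "takes c P \<Longrightarrow> (\<And>k x. P k x \<Longrightarrow> Q k x) \<Longrightarrow> takes c Q"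
  unfolding takes_iff by blast

lemma takes_singleton [simp]: "takes {Result (replicate k Tick) x} Q \<longleftrightarrow> Q k x"
  by (simp add: takes_iff)

lemma takes_return [simp]: "takes (return x) Q \<longleftrightarrow> Q 0 x"
  using takes_singleton[of 0 x Q] by (simp add: return_def)

lemma takes_pick:
  "finite S \<Longrightarrow> S \<noteq> {} \<Longrightarrow> (\<And>x. x \<in> S \<Longrightarrow> Q 1 x) \<Longrightarrow> takes (pick S) Q"
  using replicate_Suc[of 0 Tick] by (auto simp: takes_iff pick_def intro!: exI[of _ "Suc 0"])

lemma takes_bind:
  assumes "takes c (\<lambda>k x. takes (f x) (\<lambda>l. Q (k + l)))"
  shows "takes (bind_comp c f) Q"
  unfolding takes_def
proof (rule runs_bind_takes, rule takes_mono[OF assms])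
  fix k x assume "takes (f x) (\<lambda>l. Q (k + l))"
  then show "runs (f x) (\<lambda>u y. \<exists>l. replicate k Tick @ u = replicate l Tick \<and> Q l y)"
    unfolding takes_def by (rule runs_mono) (metis replicate_add)
qed

lemma bind_elapse_return: "bind_comp (elapse k) (\<lambda>_. return x) = {Result (replicate k Tick) x}"
  by (simp add: bind_comp_def elapse_def return_def)

lemma takes_set_operation [simp]:
  "takes (test_elem x S) R \<longleftrightarrow> R 1 (x \<in> S)"
  "takes (add_elem x S) Q \<longleftrightarrow> Q 1 (insert x S)"
  "takes (remove_elem x S) Q \<longleftrightarrow> Q 1 (S - {x})"
  "takes (new_set V) Q \<longleftrightarrow> Q (card V) {}"
  "takes (copy_set V A) Q \<longleftrightarrow> Q (card V) A"
  "takes (union_set V A B) Q \<longleftrightarrow> Q (card V) (A \<union> B)"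
  "takes (inter_set V A B) Q \<longleftrightarrow> Q (card V) (A \<inter> B)"
  "takes (diff_set V A B) Q \<longleftrightarrow> Q (card V) (A - B)"
  "takes (equal_set V A B) R \<longleftrightarrow> R (card V) (A = B)"
  unfolding test_elem_def add_elem_def remove_elem_def new_set_def copy_set_def union_set_def
    inter_set_def diff_set_def equal_set_def bind_elapse_return takes_singleton
  by (rule refl)+

lemmas takes_bind_set_operation = takes_set_operation[THEN iffD2, THEN takes_bind]

text \<open>\<open>V\<close> is a potential that pays for the tests and the body of the loop.\<close>

lemma takes_while:
  assumes s: "Inv s"
    and body: "\<And>s. Inv s \<Longrightarrow> b s \<Longrightarrow> takes (c s) (\<lambda>k s'. Inv s' \<and> Suc k + V s' \<le> V s)"
  shows "takes (while b c s) (\<lambda>k s'. Inv s' \<and> \<not> b s' \<and> k + V s' \<le> Suc (V s))"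
proof -
  have it: "\<exists>k. t = replicate k Tick \<and> Inv s' \<and> k + V s' \<le> V s" if "iterates b c s t s'" for t s'
    using that
  proof induction
    case start
    then show ?case using s by simp
  next
    case (iterate t s' u s'')
    then obtain k where k: "t = replicate k Tick" "Inv s'" "k + V s' \<le> V s" by blast
    obtain l where l: "u = replicate l Tick" "Inv s''" "Suc l + V s'' \<le> V s'"
      using body[OF k(2) iterate.hyps(2)] iterate.hyps(3) unfolding takes_iff by blast
    have "t @ Tick # u = replicate (k + Suc l) Tick"
      unfolding replicate_add using k l by simp
    then show ?case using k l by (intro exI[of _ "k + Suc l"]) simp
  qed
  have outcome: "\<exists>k x. r = Result (replicate k Tick) x \<and> Inv x \<and> \<not> b x \<and> k + V x \<le> Suc (V s)"
    if "r \<in> while b c s" for r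
  proof -
    consider (1) t s' where "r = Result (t @ [Tick]) s'" "iterates b c s t s'" "\<not> b s'"
      | (2) t s' where "iterates b c s t s'" "b s'" "Fail \<in> c s'"
      | (3) \<sigma> where "\<sigma> 0 = s" "\<And>i. b (\<sigma> i) \<and> (\<exists>u. Result u (\<sigma> (Suc i)) \<in> c (\<sigma> i))"
      using \<open>r \<in> while b c s\<close> unfolding while_def by blast
    then show ?thesis
    proof cases
      case 1
      then obtain k where "t = replicate k Tick" "Inv s'" "k + V s' \<le> V s" using it by blast
      then show ?thesis using 1 replicate_append_same[of k Tick]
        by (intro exI[of _ "Suc k"] exI[of _ s']) simp
    next
      case 2
      then show ?thesis using it body unfolding takes_iff by blast
    next
      case 3
      have "Inv (\<sigma> i) \<and> i + V (\<sigma> i) \<le> V s" for i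
      proof (induction i)
        case (Suc i)
        obtain u where u: "Result u (\<sigma> (Suc i)) \<in> c (\<sigma> i)" "b (\<sigma> i)" using 3 by blast
        then obtain k where "Inv (\<sigma> (Suc i))" "Suc k + V (\<sigma> (Suc i)) \<le> V (\<sigma> i)"
          using body Suc unfolding takes_iff by blast
        then show ?case using Suc by simp
      qed (use 3 s in simp)
      from this[of "Suc (V s)"] show ?thesis by simp
    qed
  qed
  \<comment> \<open>Following any outcome of the body lowers \<open>V\<close>, so some reachable
    state fails the test and yields a terminating run.\<close>
  have nonempty: "while b c s \<noteq> {}" if "iterates b c s t s'" for t s'
    using that
  proof (induction "V s'" arbitrary: s' t rule: less_induct)
    case less
    show ?case
    proof (cases "b s'")
      case True
      have "Inv s'" using it less.prems by blast
      then have c: "takes (c s') (\<lambda>k s''. Inv s'' \<and> Suc k + V s'' \<le> V s')" using body True by blast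
      then obtain q where "q \<in> c s'" unfolding takes_iff by blast
      then obtain k s'' where q: "q = Result (replicate k Tick) s''" "Suc k + V s'' \<le> V s'"
        using c unfolding takes_iff by blast
      then have k: "Result (replicate k Tick) s'' \<in> c s'" using \<open>q \<in> c s'\<close> by simp
      show ?thesis using less.hyps[OF _ iterates.iterate[OF less.prems True k]] q(2) by simp
    next
      case False
      then show ?thesis using less.prems unfolding while_def by blast
    qed
  qed
  show ?thesis
    unfolding takes_iff by (intro conjI ballI nonempty[OF iterates.start] outcome)
qed

text \<open>The \<open>3\<close> pays for the loop test, \<open>pick\<close> and
  \<open>remove_elem\<close> in each round, the \<open>1\<close> for the final test.
  \<open>Inv\<close> is indexed by the elements still to be visited.\<close>

lemma takes_foreach:
  assumes "finite S" "Inv S s"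
    and body: "\<And>todo x s. todo \<subseteq> S \<Longrightarrow> x \<in> todo \<Longrightarrow> Inv todo s \<Longrightarrow>
      takes (f x s) (\<lambda>k s'. k \<le> m \<and> Inv (todo - {x}) s')"
  shows "takes (foreach S f s) (\<lambda>k s'. k \<le> (m + 3) * card S + 1 \<and> Inv {} s')"
  unfolding foreach_def
proof (rule takes_bind, rule takes_mono, rule takes_while)
  show "case (S, s) of (todo, s) \<Rightarrow> todo \<subseteq> S \<and> Inv todo s" using assms by simp
next
  fix p :: "'a set \<times> 'b"
  obtain todo s where p: "p = (todo, s)" by fastforce
  assume *: "case p of (todo, s) \<Rightarrow> todo \<subseteq> S \<and> Inv todo s" "case p of (todo, _) \<Rightarrow> todo \<noteq> {}"
  then have "finite todo" using \<open>finite S\<close> p by (auto dest: finite_subset)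
  then have V: "(m + 3) * card (todo - {x}) + (m + 3) = (m + 3) * card todo" if "x \<in> todo" for x
    using that card_Suc_Diff1[of todo x] by (metis mult_Suc_right add.commute)
  show "takes (case p of (todo, s) \<Rightarrow> bind_comp (pick todo) (\<lambda>x. bind_comp (remove_elem x todo)
      (\<lambda>todo. bind_comp (f x s) (\<lambda>s. return (todo, s)))))
      (\<lambda>k p'. (case p' of (todo, s) \<Rightarrow> todo \<subseteq> S \<and> Inv todo s) \<and>
        Suc k + (case p' of (todo, _) \<Rightarrow> (m + 3) * card todo) \<le>
          (case p of (todo, _) \<Rightarrow> (m + 3) * card todo))"
    unfolding p prod.case
  proof (rule takes_bind, rule takes_pick, goal_cases)
    case (3 x)
    then show ?case
      using * V[OF 3] unfolding p prod.case
      by (intro takes_bind, simp only: takes_set_operation)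
        (intro takes_bind takes_mono[OF body[of todo x s]], auto)
  qed (use * \<open>finite todo\<close> p in auto)
qed auto

text \<open>The common shape of the inner loops of both graph searches. A target met twice is found
  to be old the second time, so the result does not depend on the order.\<close>

lemma takes_foreach_add:
  assumes "finite S"
    and body: "\<And>x P A. x \<in> S \<Longrightarrow> takes (f x (P, A)) (\<lambda>k s. k \<le> m \<and>
      s = (if c x \<and> g x \<notin> A then (insert (g x) P, insert (g x) A) else (P, A)))"
  shows "takes (foreach S f (P, A)) (\<lambda>k s. k \<le> (m + 3) * card S + 1 \<and>
    s = (P \<union> (g ` {x\<in>S. c x} - A), A \<union> g ` {x\<in>S. c x}))"
proof -
  let ?D = "\<lambda>todo. g ` {x \<in> S - todo. c x}"
  have "takes (foreach S f (P, A)) (\<lambda>k s. k \<le> (m + 3) * card S + 1 \<and>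
      s = (P \<union> (?D {} - A), A \<union> ?D {}))"
  proof (rule takes_foreach[where Inv = "\<lambda>todo s. s = (P \<union> (?D todo - A), A \<union> ?D todo)"])
    fix todo x s assume *: "todo \<subseteq> S" "x \<in> todo" "s = (P \<union> (?D todo - A), A \<union> ?D todo)"
    define E where "E = ?D todo"
    have "?D (todo - {x}) = (if c x then insert (g x) E else E)"
      using * by (auto simp: E_def)
    then have "(if c x \<and> g x \<notin> A \<union> E
          then (insert (g x) (P \<union> (E - A)), insert (g x) (A \<union> E)) else (P \<union> (E - A), A \<union> E)) =
        (P \<union> (?D (todo - {x}) - A), A \<union> ?D (todo - {x}))"
      by (simp split: if_splits) blast
    then show "takes (f x s) (\<lambda>k s. k \<le> m \<and> s = (P \<union> (?D (todo - {x}) - A), A \<union> ?D (todo - {x})))"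
      using * body[of x "P \<union> (E - A)" "A \<union> E"] by (auto simp: E_def)
  qed (use assms in auto)
  then show ?thesis by simp
qed

section \<open>Worklist search and its potential\<close>

text \<open>\<open>A\<close> is the discovered set, \<open>P\<close> the worklist and
  \<open>U\<close> a universe that bounds both. The last conjunct makes \<open>A\<close> closed
  under \<open>r\<close> once the worklist is empty.\<close>

definition search_inv :: "('a \<times> 'a) set \<Rightarrow> 'a set \<Rightarrow> 'a set \<Rightarrow> 'a set \<Rightarrow> 'a set \<Rightarrow> bool" where
  "search_inv r X U P A \<longleftrightarrow>
     X \<subseteq> A \<and> P \<subseteq> A \<and> A \<subseteq> U \<and> A \<subseteq> r\<^sup>* `` X \<and> r `` (A - P) \<subseteq> A"

lemma search_inv_init: "X \<subseteq> U \<Longrightarrow> search_inv r X U X X"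
  by (auto simp: search_inv_def)

lemma search_inv_step:
  assumes "search_inv r X U P A" "s \<in> P" "r `` {s} \<subseteq> U"
  shows "search_inv r X U (P - {s} \<union> (r `` {s} - A)) (A \<union> r `` {s})"
proof -
  have "r `` {s} \<subseteq> r\<^sup>* `` X"
    using assms(1,2) unfolding search_inv_def by (blast intro: rtrancl.rtrancl_into_rtrancl)
  then show ?thesis using assms unfolding search_inv_def by auto
qed

lemma search_inv_finished: "search_inv r X U {} A \<Longrightarrow> A = r\<^sup>* `` X"
  unfolding search_inv_def using Image_closed_trancl[of r A] rtrancl_mono by blast

text \<open>The nodes still to be processed are those on the worklist and those not yet found.\<close>

lemma search_potential_step:
  fixes w :: "'a \<Rightarrow> nat"
  assumes "search_inv r X U P A" "s \<in> P" "r `` {s} \<subseteq> U" "finite U"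
  shows "sum w (P - {s} \<union> (r `` {s} - A) \<union> (U - (A \<union> r `` {s}))) + w s = sum w (P \<union> (U - A))"
proof -
  have "P - {s} \<union> (r `` {s} - A) \<union> (U - (A \<union> r `` {s})) = (P \<union> (U - A)) - {s}"
    using assms(1-3) by (auto simp: search_inv_def)
  moreover have "finite (P \<union> (U - A))"
    using assms(1,4) by (auto simp: search_inv_def intro: finite_subset)
  ultimately show ?thesis using assms(2) by (simp add: sum.remove[of _ s w])
qed

section \<open>Searching a mixed graph\<close>

lemma finite_edges:
  assumes "mixed_graph G"
  shows "finite (directed G)" "finite (undirected G)" "finite (bidirected G)"
proof -
  have "finite (nodes G)" "undirected G \<subseteq> Pow (nodes G)" "bidirected G \<subseteq> Pow (nodes G)"
    "directed G \<subseteq> nodes G \<times> nodes G"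
    using assms by (auto simp: mixed_graph_def dest!: subsetD)
  then show "finite (directed G)" "finite (undirected G)" "finite (bidirected G)"
    by (auto intro: finite_subset)
qed

lemma card_ends_le:
  assumes "finite E" "E \<subseteq> {{a, b} | a b. P a b}"
  shows "finite {(A, B). {A, B} \<in> E}" "card {(A, B). {A, B} \<in> E} \<le> 2 * card E"
proof -
  have *: "finite {(A, B). {A, B} = e} \<and> card {(A, B). {A, B} = e} \<le> 2" if "e \<in> E" for e
  proof -
    obtain a b where "e = {a, b}" using \<open>e \<in> E\<close> assms(2) by auto
    then have "{(A, B). {A, B} = e} \<subseteq> {(a, b), (b, a)}" by (auto simp: doubleton_eq_iff)
    then have "finite {(A, B). {A, B} = e}" "card {(A, B). {A, B} = e} \<le> card {(a, b), (b, a)}"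
      by (auto intro: finite_subset card_mono)
    moreover have "card {(a, b), (b, a)} \<le> 2" by (cases "a = b") simp_all
    ultimately show ?thesis by simp
  qed
  have eq: "{(A, B). {A, B} \<in> E} = (\<Union>e\<in>E. {(A, B). {A, B} = e})" by auto
  show "finite {(A, B). {A, B} \<in> E}" unfolding eq using assms(1) * by blast
  have "card {(A, B). {A, B} \<in> E} \<le> (\<Sum>e\<in>E. card {(A, B). {A, B} = e})"
    unfolding eq by (rule card_UN_le[OF assms(1)])
  also have "\<dots> \<le> (\<Sum>e\<in>E. 2)" by (rule sum_mono) (use * in blast)
  finally show "card {(A, B). {A, B} \<in> E} \<le> 2 * card E" by simp
qed

text \<open>The handshake count: each edge is read at most once from each end. A directed edge
  counts once as \<open>Forward\<close> and once as \<open>Backward\<close>.\<close>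

lemma
  assumes G: "mixed_graph G"
  shows finite_incident: "finite (incident G T)"
    and sum_degree_le: "(\<Sum>T\<in>nodes G. card (incident G T)) \<le> 2 * num_edges G"
proof -
  let ?i = "\<lambda>f. \<lambda>(A, B). (A, f :: edge_type, B)"
  define P where "P = (\<lambda>f. {(A, B). edge G A f B})"
  have und: "undirected G \<subseteq> {{a, b} | a b. a \<in> nodes G \<and> b \<in> nodes G \<and> a \<noteq> b}"
    and bid: "bidirected G \<subseteq> {{a, b} | a b. a \<in> nodes G \<and> b \<in> nodes G \<and> a \<noteq> b}"
    using G by (auto simp: mixed_graph_def)
  have P: "P Forward = directed G" "P Backward = (directed G)\<inverse>"
    "P Undirected = {(A, B). {A, B} \<in> undirected G}" "P Bidirected = {(A, B). {A, B} \<in> bidirected G}"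
    by (auto simp: P_def)
  have fin: "finite (P f)" for f
    using finite_edges[OF G] card_ends_le(1)[OF _ und] card_ends_le(1)[OF _ bid]
    by (cases f) (simp_all add: P)
  define E where "E = {(A, f, B). edge G A f B}"
  have "A \<in> (\<Union>f\<in>{Forward, Backward, Undirected, Bidirected}. ?i f ` P f)" if A: "A \<in> E" for A
  proof -
    obtain T f N where "A = (T, f, N)" "edge G T f N"
      using A unfolding E_def by blast
    then show ?thesis by (cases f) (auto simp: P_def image_iff)
  qed
  then have E: "E \<subseteq> (\<Union>f\<in>{Forward, Backward, Undirected, Bidirected}. ?i f ` P f)" (is "_ \<subseteq> ?U") by blast
  have finU: "finite ?U" using fin by blast
  then have finE: "finite E" using E by (rule finite_subset[rotated])
  have "card E \<le> card ?U" by (rule card_mono[OF finU E])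
  also have "\<dots> \<le> (\<Sum>f\<in>{Forward, Backward, Undirected, Bidirected}. card (?i f ` P f))"
    by (rule card_UN_le) simp
  also have "\<dots> \<le> (\<Sum>f\<in>{Forward, Backward, Undirected, Bidirected}. card (P f))"
    by (rule sum_mono) (rule card_image_le[OF fin])
  also have "\<dots> \<le> 2 * num_edges G"
    using card_ends_le(2)[OF finite_edges(2)[OF G] und] card_ends_le(2)[OF finite_edges(3)[OF G] bid]
    by (simp add: P num_edges_def)
  finally have card: "card E \<le> 2 * num_edges G" .
  have inc: "finite (incident G T)" for T
  proof (rule finite_subset)
    show "incident G T \<subseteq> snd ` E" by (force simp: incident_def E_def)
  qed (use finE in simp)
  then show "finite (incident G T)" .
  have "(\<Sum>T\<in>nodes G. card (incident G T)) = card (SIGMA T:nodes G. incident G T)"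
    using G inc by (simp add: mixed_graph_def)
  also have "\<dots> \<le> card E"
    by (rule card_mono[OF finE]) (auto simp: E_def incident_def)
  finally show "(\<Sum>T\<in>nodes G. card (incident G T)) \<le> 2 * num_edges G" using card by simp
qed

text \<open>The weight bounds one visit of \<open>T\<close> in either search. Each incident edge
  costs at most \<open>4\<close> ticks in the body of the inner loop and \<open>3\<close> in
  overhead; the \<open>5\<close> covers the outer test, \<open>pick\<close>,
  \<open>remove_elem\<close>, the last inner test and, in \<open>TestSep\<close>, the test for
  \<open>Y\<close>.\<close>

lemma sum_visit_cost_le:
  assumes "mixed_graph G"
  shows "(\<Sum>T\<in>nodes G. 7 * card (incident G T) + 5) \<le> 14 * num_edges G + 5 * num_nodes G"
proof -
  have "(\<Sum>T\<in>nodes G. 7 * card (incident G T) + 5) = 7 * (\<Sum>T\<in>nodes G. card (incident G T)) + 5 * num_nodes G"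
    by (simp add: sum.distrib sum_distrib_left num_nodes_def)
  then show ?thesis using sum_degree_le[OF assms] by simp
qed

lemma UNIV_edge_type: "(UNIV :: edge_type set) = {Forward, Backward, Undirected, Bidirected}"
  using edge_type.exhaust by auto

lemma finite_UNIV_edge_type: "finite (UNIV :: edge_type set)"
  by (simp add: UNIV_edge_type)

lemma card_UNIV_edge_type: "card (UNIV :: edge_type set) = 4"
  by (simp add: UNIV_edge_type)

section \<open>Correctness and cost of \<open>TestSep\<close>, \<open>Anteriors\<close> and
  \<open>FindSep\<close>\<close>

lemma m_step_Image:
  "m_step G Z Z `` {(e, T)} = {x \<in> incident G T. case x of (f, N) \<Rightarrow> m_connecting e (T \<in> Z) f}"
  by (auto simp: m_step_def m_connecting_def incident_def split: if_splits)

text \<open>A node has four states, one for each type of entering edge, so the search costs at most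
  four times \<open>sum_visit_cost_le\<close>. The remaining \<open>12 * num_nodes G + 2\<close>
  pays for \<open>new_set\<close>, \<open>copy_set\<close>, the loop over \<open>X\<close> and the
  last loop test.\<close>

lemma takes_TestSep:
  assumes G: "mixed_graph G" and X: "X \<subseteq> nodes G"
  shows "takes (TestSep G X Y Z) (\<lambda>k sep. k \<le> 56 * num_edges G + 32 * num_nodes G + 2 \<and>
    (sep \<longleftrightarrow> \<not> (\<exists>x\<in>X. \<exists>e. \<exists>y\<in>Y. ((Backward, x), (e, y)) \<in> (m_step G Z Z)\<^sup>*)))"
proof -
  let ?r = "m_step G Z Z" and ?X = "Pair Backward ` X" and ?U = "(UNIV :: edge_type set) \<times> nodes G"
  let ?w = "\<lambda>(e :: edge_type, T). 7 * card (incident G T) + 5"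
  have fin: "finite (nodes G)" using G by (simp add: mixed_graph_def)
  then have finU: "finite ?U" using finite_UNIV_edge_type by simp
  have finX: "finite X" using X fin by (rule finite_subset)
  have r: "?r `` {s} \<subseteq> ?U" for s using m_step_nodes[OF G] by force
  have "sum ?w ?U = (\<Sum>e\<in>(UNIV :: edge_type set). \<Sum>T\<in>nodes G. 7 * card (incident G T) + 5)"
    by (rule sum.cartesian_product[symmetric])
  also have "\<dots> \<le> 4 * (14 * num_edges G + 5 * num_nodes G)"
    using sum_visit_cost_le[OF G] by (simp add: card_UNIV_edge_type)
  finally have cost: "sum ?w ?U \<le> 56 * num_edges G + 20 * num_nodes G" by simp
  \<comment> \<open>A reachable witness in \<open>Y\<close> justifies the answer false even though
    the search is left early; the answer true rests on all processed states.\<close>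
  let ?Inv = "\<lambda>(P, Q, sep). search_inv ?r ?X ?U P Q \<and>
    (if sep then \<forall>s\<in>Q - P. snd s \<notin> Y else \<exists>s\<in>?r\<^sup>* `` ?X. snd s \<in> Y)"
  let ?V = "\<lambda>(P, Q, sep :: bool). sum ?w (P \<union> (?U - Q))"
  let ?b = "\<lambda>(P :: (edge_type \<times> 'a) set, Q :: (edge_type \<times> 'a) set, sep). sep \<and> P \<noteq> {}"
  have body: "takes (case s of (P, Q, sep) \<Rightarrow>
        bind_comp (pick P) (\<lambda>(e, T). bind_comp (remove_elem (e, T) P) (\<lambda>P.
          bind_comp (foreach (incident G T)
            (\<lambda>(f, N) (P, Q). bind_comp (test_elem T Z) (\<lambda>z.
               bind_comp (test_elem (f, N) Q) (\<lambda>old.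
               if m_connecting e z f \<and> \<not> old then
                 bind_comp (add_elem (f, N) P) (\<lambda>P. bind_comp (add_elem (f, N) Q) (\<lambda>Q. return (P, Q)))
               else return (P, Q))))
            (P, Q)) (\<lambda>(P, Q). bind_comp (test_elem T Y) (\<lambda>y. return (P, Q, \<not> y))))))
      (\<lambda>k s'. ?Inv s' \<and> Suc k + ?V s' \<le> ?V s)"
    if s: "?Inv s" "?b s" for s
  proof -
    obtain P Q where PQ: "s = (P, Q, True)" "P \<noteq> {}" using s by (cases s) auto
    have inv: "search_inv ?r ?X ?U P Q" and Y: "\<forall>s\<in>Q - P. snd s \<notin> Y" using s PQ by auto
    then have "finite P" using finU by (meson finite_subset search_inv_def)
    show ?thesis unfolding PQ(1) prod.case
    proof (rule takes_bind, rule takes_pick, goal_cases)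
      case (3 s)
      obtain e T where s: "s = (e, T)" by fastforce
      let ?S = "?r `` {(e, T)}"
      note step = search_inv_step[OF inv 3 r]
        search_potential_step[OF inv 3 r finU, of ?w]
      have Y': "\<forall>s\<in>(Q \<union> ?S) - (P - {s} \<union> (?S - Q)). snd s \<notin> Y" if "T \<notin> Y"
        using Y that s by auto
      have "s \<in> ?r\<^sup>* `` ?X" using 3 inv by (auto simp: search_inv_def)
      then have Y'': "\<exists>s\<in>?r\<^sup>* `` ?X. snd s \<in> Y" if "T \<in> Y" using that s by force
      show ?case unfolding s prod.case
      proof (rule takes_bind_set_operation, rule takes_bind, rule takes_mono,
          rule takes_foreach_add[where m = 4 and g = "\<lambda>x. x"
            and c = "\<lambda>(f, N). m_connecting e (T \<in> Z) f"], goal_cases)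
        case 1
        show ?case by (rule finite_incident[OF G])
      next
        case (2 x P A)
        obtain f N where x: "x = (f, N)" by fastforce
        show ?case
          unfolding x prod.case by (intro takes_bind_set_operation) (auto intro!: takes_bind_set_operation)
      next
        case (3 k s')
        define P' Q' where "P' = P - {s} \<union> (?S - Q)" and "Q' = Q \<union> ?S"
        then have s': "s' = (P', Q')" and k: "k \<le> 7 * card (incident G T) + 1"
          using 3 by (simp_all add: s m_step_Image P'_def Q'_def)
        show ?case unfolding s' prod.case
          using step Y' Y'' k
          by (intro takes_bind_set_operation) (simp add: s P'_def Q'_def)
      qed
    qed (use PQ \<open>finite P\<close> in auto)
  qed
  show ?thesis
    unfolding TestSep_def
  proof (rule takes_bind_set_operation, rule takes_bind, rule takes_mono,
      rule takes_foreach[where m = 1 and Inv = "\<lambda>todo P. P = Pair Backward ` (X - todo)"], goal_cases)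
    case (3 todo x P)
    then show ?case by auto
  next
    case (4 k P)
    then have P: "P = ?X" and k: "k \<le> 4 * card X + 1" by simp_all
    have cX: "card X \<le> num_nodes G" using card_mono[OF fin X] by (simp add: num_nodes_def)
    have cU: "card ?U = 4 * num_nodes G"
      by (simp add: card_cartesian_product card_UNIV_edge_type num_nodes_def)
    have U: "?X \<union> (?U - ?X) = ?U" using X by auto
    show ?case unfolding P
    proof (rule takes_bind_set_operation, rule takes_bind, rule takes_mono,
        rule takes_while[where Inv = ?Inv and V = ?V], goal_cases)
      case 1
      have "?X \<subseteq> ?U" using X by auto
      then show ?case by (simp add: search_inv_init)
    next
      case (2 s)
      then show ?case by (rule body)
    next
      case (3 l s)
      obtain P Q sep where s: "s = (P, Q, sep)" by (cases s)
      have l: "l \<le> Suc (sum ?w ?U)" using 3 unfolding s prod.case U by linarith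
      have inv: "?Inv (P, Q, sep)" and "\<not> (sep \<and> P \<noteq> {})" using 3 unfolding s by auto
      have "sep \<longleftrightarrow> \<not> (\<exists>s\<in>?r\<^sup>* `` ?X. snd s \<in> Y)"
      proof (cases sep)
        case True
        then have "P = {}" using \<open>\<not> (sep \<and> P \<noteq> {})\<close> by simp
        then show ?thesis using inv True search_inv_finished[of ?r ?X ?U Q] by auto
      qed (use inv in simp)
      also have "\<dots> \<longleftrightarrow> \<not> (\<exists>x\<in>X. \<exists>e. \<exists>y\<in>Y. ((Backward, x), (e, y)) \<in> ?r\<^sup>*)" by force
      finally show ?case
        using l k cX cost unfolding s prod.case takes_return cU by simp
    qed
  qed (use finX in auto)
qed

text \<open>The search follows the converse of the anterior steps and visits each node at most once.
  Two copies of \<open>S\<close> and the last loop test make up the rest of the bound.\<close>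

lemma takes_Anteriors:
  assumes G: "mixed_graph G" and S: "S \<subseteq> nodes G"
  shows "takes (Anteriors G S) (\<lambda>k A. k \<le> 14 * num_edges G + 7 * num_nodes G + 1 \<and> A = Ant G S)"
proof -
  define r where "r = {(T, N). edge G T Backward N \<or> edge G T Undirected N}"
  have r_eq: "r = {(A, B). edge G A Forward B \<or> edge G A Undirected B}\<inverse>"
    by (auto simp: r_def insert_commute)
  let ?U = "nodes G"
  let ?w = "\<lambda>T. 7 * card (incident G T) + 5"
  have fin: "finite ?U" using G by (simp add: mixed_graph_def)
  have r: "r `` {s} \<subseteq> ?U" for s using edge_nodes[OF G] by (auto simp: r_def simp del: edge.simps)
  have r_Image: "r `` {T} = snd ` {x \<in> incident G T. case x of (f, N) \<Rightarrow> f = Backward \<or> f = Undirected}" for T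
    by (force simp: r_def incident_def simp del: edge.simps)
  have "W \<in> S \<Longrightarrow> (W, U) \<in> r\<^sup>* \<Longrightarrow> U \<in> nodes G" for U W
    by (erule rtranclE) (use S r in auto)
  then have Ant: "r\<^sup>* `` S = Ant G S"
    by (auto simp: Ant_def anterior_iff[OF G] r_eq rtrancl_converse simp del: edge.simps)
  let ?Inv = "\<lambda>(P, A). search_inv r S ?U P A"
  let ?V = "\<lambda>(P, A). sum ?w (P \<union> (?U - A))"
  have body: "takes (case s of (P, A) \<Rightarrow>
        bind_comp (pick P) (\<lambda>T. bind_comp (remove_elem T P) (\<lambda>P.
          foreach (incident G T)
            (\<lambda>(f, N) (P, A). bind_comp (test_elem N A) (\<lambda>old.
               if (f = Backward \<or> f = Undirected) \<and> \<not> old then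
                 bind_comp (add_elem N P) (\<lambda>P. bind_comp (add_elem N A) (\<lambda>A. return (P, A)))
               else return (P, A)))
            (P, A))))
      (\<lambda>k s'. ?Inv s' \<and> Suc k + ?V s' \<le> ?V s)"
    if s: "?Inv s" "case s of (P, _) \<Rightarrow> P \<noteq> {}" for s
  proof -
    obtain P A where PA: "s = (P, A)" by fastforce
    have inv: "search_inv r S ?U P A" and ne: "P \<noteq> {}" using s PA by auto
    then have "finite P" using fin by (meson finite_subset search_inv_def)
    show ?thesis unfolding PA prod.case
    proof (rule takes_bind, rule takes_pick, goal_cases)
      case (3 T)
      let ?S = "r `` {T}"
      note step = search_inv_step[OF inv 3 r]
        search_potential_step[OF inv 3 r fin, of ?w]
      show ?case
      proof (rule takes_bind_set_operation, rule takes_mono,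
          rule takes_foreach_add[where m = 4 and g = snd
            and c = "\<lambda>(f, N). f = Backward \<or> f = Undirected"], goal_cases)
        case 1
        show ?case by (rule finite_incident[OF G])
      next
        case (2 x P A)
        obtain f N where x: "x = (f, N)" by fastforce
        show ?case
          unfolding x prod.case by (intro takes_bind_set_operation) (auto intro!: takes_bind_set_operation)
      next
        case (3 k s')
        define P' A' where "P' = P - {T} \<union> (?S - A)" and "A' = A \<union> ?S"
        then have s': "s' = (P', A')" and k: "k \<le> 7 * card (incident G T) + 1"
          using 3 by (simp_all add: r_Image P'_def A'_def)
        show ?case unfolding s' prod.case
          using step k by (simp add: P'_def A'_def)
      qed
    qed (use ne \<open>finite P\<close> in auto)
  qed
  show ?thesis
    unfolding Anteriors_def
  proof (rule takes_bind_set_operation, rule takes_bind_set_operation, rule takes_bind, rule takes_mono,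
      rule takes_while[where Inv = ?Inv and V = ?V], goal_cases)
    case 1
    show ?case using search_inv_init[OF S] by simp
  next
    case (2 s)
    then show ?case by (rule body)
  next
    case (3 k s)
    obtain P A where s: "s = (P, A)" by fastforce
    have U: "S \<union> (?U - S) = ?U" using S by auto
    have "k \<le> Suc (sum ?w ?U)" using 3 unfolding s prod.case U by linarith
    moreover have "A = Ant G S"
      using 3 search_inv_finished[of r S ?U A] unfolding s Ant by auto
    ultimately show ?case
      using sum_visit_cost_le[OF G] unfolding s prod.case takes_return num_nodes_def by simp
  qed
qed

text \<open>By \<open>m_separator_Ant_Int\<close> one candidate decides whether any admissible
  separator exists; it contains \<open>I\<close> since every node is its own anterior. The total
  \<open>70 * num_edges G + 43 * num_nodes G + 3\<close> fits the bound because the nonempty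
  \<open>X\<close> provides a node.\<close>

lemma takes_FindSep:
  assumes G: "ancestral_graph G"
    and X: "X \<subseteq> nodes G" "X \<inter> R = {}" "X \<noteq> {}" and Y: "Y \<subseteq> nodes G" "Y \<inter> R = {}"
    and R: "R \<subseteq> nodes G" "I \<subseteq> R"
  shows "takes (FindSep G X Y I R) (\<lambda>k s. k \<le> 70 * (num_nodes G + num_edges G) \<and>
    (s \<noteq> None \<longleftrightarrow> (\<exists>Z. m_separator G X Y Z \<and> I \<subseteq> Z \<and> Z \<subseteq> R)))"
proof -
  have mG: "mixed_graph G" using G by (simp add: ancestral_graph_def)
  have "finite (nodes G)" using mG by (simp add: mixed_graph_def)
  then have n: "num_nodes G > 0" using X by (auto simp: num_nodes_def card_gt_0_iff)
  have S: "X \<union> Y \<union> I \<subseteq> nodes G" using X Y R by blast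
  let ?Z = "Ant G (X \<union> Y \<union> I) \<inter> (R - (X \<union> Y))"
  have Z_eq: "?Z = Ant G (X \<union> Y \<union> I) \<inter> R" using X Y by blast
  have "I \<subseteq> ?Z" using R Ant_self[OF mG] unfolding Z_eq by blast
  then have sep: "m_separator G X Y ?Z \<longleftrightarrow> (\<exists>Z. m_separator G X Y Z \<and> I \<subseteq> Z \<and> Z \<subseteq> R)"
    using m_separator_Ant_Int[OF G X(1,2) Y R(1)] unfolding Z_eq by blast
  have walk: "m_separator G X Y ?Z \<longleftrightarrow>
      \<not> (\<exists>x\<in>X. \<exists>e. \<exists>y\<in>Y. ((Backward, x), (e, y)) \<in> (m_step G ?Z ?Z)\<^sup>*)"
    by (rule m_separator_iff_walk[OF G X(1)]) auto
  show ?thesis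
    unfolding FindSep_def
  proof (intro takes_bind_set_operation, rule takes_bind, rule takes_mono, rule takes_Anteriors[OF mG S],
      goal_cases)
    case (1 k A)
    show ?case
    proof (rule takes_bind_set_operation, rule takes_bind, rule takes_mono, rule takes_TestSep[OF mG X(1)],
        goal_cases)
      case (1 l s)
      have A: "A = Ant G (X \<union> Y \<union> I)" and k: "k \<le> 14 * num_edges G + 7 * num_nodes G + 1"
        using \<open>k \<le> _ \<and> A = _\<close> by simp_all
      have l: "l \<le> 56 * num_edges G + 32 * num_nodes G + 2" using 1 by simp
      have "s \<longleftrightarrow> m_separator G X Y ?Z" using 1 unfolding A walk by blast
      then show ?case using k l n sep by (simp add: num_nodes_def)
    qed
  qed
qed

section \<open>Delay\<close>

lemma outputs_append [simp]: "outputs (t @ u) = outputs t @ outputs u"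
  by (induction t rule: outputs.induct) simp_all

lemma outputs_replicate_Tick [simp]: "outputs (replicate k Tick) = []"
  by (induction k) simp_all

lemma delays_replicate_Tick [simp]: "delays k (replicate j Tick @ t) = delays (k + j) t"
  by (induction j arbitrary: k) simp_all

lemma delays_replicate [simp]: "delays k (replicate j Tick) = [k + j]"
  by (induction j arbitrary: k) simp_all

lemma delays_not_Nil [simp]: "delays k t \<noteq> []"
  by (induction k t rule: delays.induct) simp_all

lemma delays_append: "delays k (t @ u) = butlast (delays k t) @ delays (last (delays k t)) u"
  by (induction k t rule: delays.induct) simp_all

lemma delays_offset: "delays (j + k) t = (j + hd (delays k t)) # tl (delays k t)"
  by (induction k t rule: delays.induct) simp_all

text \<open>The trace of a call of \<open>ListSep\<close> whose solutions are \<open>S\<close> and whose recursion has depth \<open>h\<close>,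
  if the work between two recursive calls takes at most \<open>B\<close>. A failing call outputs nothing and costs
  only \<open>B\<close>; hence at most \<open>2 * h + 1\<close> calls precede the first output, and at most \<open>h\<close> calls follow
  the last one.\<close>

definition call_trace :: "nat \<Rightarrow> nat \<Rightarrow> 'o set \<Rightarrow> 'o event list \<Rightarrow> bool" where
  "call_trace B h S t \<longleftrightarrow>
     (if S = {} then \<exists>k\<le>B. t = replicate k Tick
      else distinct (outputs t) \<and> set (outputs t) = S \<and>
        (\<exists>a ds l. delays 0 t = a # ds @ [l] \<and> a \<le> (2 * h + 1) * B \<and> l \<le> h * B \<and>
          (\<forall>d\<in>set ds. d \<le> (3 * h + 1) * B)))"

lemma call_trace_empty: "call_trace B h {} t \<longleftrightarrow> (\<exists>k\<le>B. t = replicate k Tick)"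
  by (simp add: call_trace_def)

lemma call_trace_nonempty:
  "S \<noteq> {} \<Longrightarrow> call_trace B h S t \<longleftrightarrow> distinct (outputs t) \<and> set (outputs t) = S \<and>
    (\<exists>a ds l. delays 0 t = a # ds @ [l] \<and> a \<le> (2 * h + 1) * B \<and> l \<le> h * B \<and>
      (\<forall>d\<in>set ds. d \<le> (3 * h + 1) * B))"
  by (simp add: call_trace_def)

lemma call_trace_leaf: "k \<le> B \<Longrightarrow> call_trace B 0 {z} (replicate k Tick @ [Output z])"
  by (auto simp: call_trace_nonempty intro!: exI[of _ "[]"])

text \<open>A failing child is a wait of at most \<open>B\<close>. If the first child fails, this
  wait and \<open>k\<close> raise the first period by at most \<open>2 * B\<close>; a failing second
  child adds at most \<open>B\<close> to the last period. If both succeed, a last and a first period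
  merge into at most \<open>h * B + (2 * h + 1) * B\<close>.\<close>

lemma call_trace_node:
  assumes t: "call_trace B h S t" and u: "call_trace B h S' u" and k: "k \<le> B"
    and S: "S \<inter> S' = {}" "S \<union> S' \<noteq> {}"
  shows "call_trace B (Suc h) (S \<union> S') (replicate k Tick @ t @ u)"
proof -
  let ?t = "replicate k Tick @ t @ u"
  consider (left) "S = {}" "S' \<noteq> {}" | (right) "S \<noteq> {}" "S' = {}" | (both) "S \<noteq> {}" "S' \<noteq> {}"
    using S by blast
  note cases = this
  have o: "distinct (outputs v) \<and> set (outputs v) = R" if "call_trace B h R v" for R and v :: "'a event list"
    using that by (auto simp: call_trace_def split: if_splits)
  have nonempty: "\<exists>a ds l. delays 0 v = a # ds @ [l] \<and> a \<le> (2 * h + 1) * B \<and> l \<le> h * B \<and>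
      (\<forall>d\<in>set ds. d \<le> (3 * h + 1) * B)"
    if "call_trace B h R v" "R \<noteq> {}" for R and v :: "'a event list"
    using that by (simp add: call_trace_nonempty)
  have mono: "d \<le> (3 * h + 1) * B \<Longrightarrow> d \<le> (3 * Suc h + 1) * B" for d
    by (simp add: algebra_simps)
  have "\<exists>a ds l. delays 0 ?t = a # ds @ [l] \<and> a \<le> (2 * Suc h + 1) * B \<and> l \<le> Suc h * B \<and>
      (\<forall>d\<in>set ds. d \<le> (3 * Suc h + 1) * B)"
  proof (cases rule: cases)
    case left
    obtain j where j: "j \<le> B" "t = replicate j Tick" using t left by (auto simp: call_trace_empty)
    obtain a ds l where d: "delays 0 u = a # ds @ [l]" "a \<le> (2 * h + 1) * B" "l \<le> h * B"
        "\<forall>d\<in>set ds. d \<le> (3 * h + 1) * B"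
      using nonempty[OF u] left by blast
    have "delays 0 ?t = (k + j + a) # ds @ [l]"
      using delays_offset[of "k + j" 0 u] by (simp add: j d)
    moreover have "k + j + a \<le> (2 * Suc h + 1) * B" "l \<le> Suc h * B"
      using d k j by (simp_all add: algebra_simps)
    ultimately show ?thesis using d(4) mono by blast
  next
    case right
    obtain j where j: "j \<le> B" "u = replicate j Tick" using u right by (auto simp: call_trace_empty)
    obtain a ds l where d: "delays 0 t = a # ds @ [l]" "a \<le> (2 * h + 1) * B" "l \<le> h * B"
        "\<forall>d\<in>set ds. d \<le> (3 * h + 1) * B"
      using nonempty[OF t] right by blast
    have "delays 0 ?t = (k + a) # ds @ [l + j]"
      using delays_offset[of k 0 t] by (simp add: j d delays_append[of k t])
    moreover have "k + a \<le> (2 * Suc h + 1) * B" "l + j \<le> Suc h * B"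
      using d k j by (simp_all add: algebra_simps)
    ultimately show ?thesis using d(4) mono by blast
  next
    case both
    obtain a ds l where d: "delays 0 t = a # ds @ [l]" "a \<le> (2 * h + 1) * B" "l \<le> h * B"
        "\<forall>d\<in>set ds. d \<le> (3 * h + 1) * B"
      using nonempty[OF t] both by blast
    obtain a' ds' l' where d': "delays 0 u = a' # ds' @ [l']" "a' \<le> (2 * h + 1) * B" "l' \<le> h * B"
        "\<forall>d\<in>set ds'. d \<le> (3 * h + 1) * B"
      using nonempty[OF u] both by blast
    have "delays 0 ?t = (k + a) # (ds @ (l + a') # ds') @ [l']"
      using delays_offset[of k 0 t] delays_offset[of l 0 u]
      by (simp add: d d' delays_append[of k t])
    moreover have "k + a \<le> (2 * Suc h + 1) * B" "l' \<le> Suc h * B" "l + a' \<le> (3 * h + 1) * B"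
      using d(2,3) d'(2,3) k by (simp_all add: algebra_simps)
    moreover from this have "\<forall>d\<in>set (ds @ (l + a') # ds'). d \<le> (3 * Suc h + 1) * B"
      using d(4) d'(4) mono by auto
    ultimately show ?thesis by blast
  qed
  moreover have "distinct (outputs ?t) \<and> set (outputs ?t) = S \<union> S'"
    using o[OF t] o[OF u] S by auto
  ultimately show ?thesis unfolding call_trace_nonempty[OF S(2)] by blast
qed

lemma call_trace_delays:
  assumes "call_trace B h S t"
  shows "distinct (outputs t)" "set (outputs t) = S" "d \<in> set (delays 0 t) \<Longrightarrow> d \<le> (3 * h + 1) * B"
proof -
  have le: "h * B \<le> (3 * h + 1) * B" "(2 * h + 1) * B \<le> (3 * h + 1) * B" "B \<le> (3 * h + 1) * B"
    by (simp_all add: algebra_simps)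
  show "distinct (outputs t)" "set (outputs t) = S"
    using assms by (auto simp: call_trace_def split: if_splits)
  show "d \<le> (3 * h + 1) * B" if "d \<in> set (delays 0 t)"
  proof (cases "S = {}")
    case True
    then obtain k where "k \<le> B" "t = replicate k Tick" using assms by (auto simp: call_trace_empty)
    then show ?thesis using that le(3) by simp
  next
    case False
    then obtain a ds l where "delays 0 t = a # ds @ [l]" "a \<le> (2 * h + 1) * B" "l \<le> h * B"
        "\<forall>d\<in>set ds. d \<le> (3 * h + 1) * B"
      using assms by (auto simp: call_trace_nonempty)
    then show ?thesis using that le(1,2) by auto
  qed
qed

section \<open>Correctness and delay of \<open>ListSep\<close>\<close>

lemma runs_print_set: "runs (print_set V A) Q \<longleftrightarrow> Q (replicate (card V) Tick @ [Output A]) ()"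
  by (simp add: print_set_def emit_def elapse_def bind_comp_def)

lemmas runs_bind_set_operation = takes_set_operation[THEN iffD2, THEN runs_bind_takes]

declare ListSep.simps [simp del]

text \<open>The solutions are split by whether they contain \<open>v\<close>, and each child has
  exactly one undecided node less, so \<open>card (R - I)\<close> bounds the depth.\<close>

lemma runs_ListSep:
  assumes G: "ancestral_graph G"
    and X: "X \<subseteq> nodes G" "X \<inter> R = {}" "X \<noteq> {}" and Y: "Y \<subseteq> nodes G" "Y \<inter> R = {}"
    and R: "R \<subseteq> nodes G" "I \<subseteq> R"
  shows "runs (ListSep G X Y I R) (\<lambda>t _. call_trace (75 * (num_nodes G + num_edges G)) (card (R - I))
    {Z. m_separator G X Y Z \<and> I \<subseteq> Z \<and> Z \<subseteq> R} t)"
  using X(2) Y(2) R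
proof (induction "card (R - I)" arbitrary: I R rule: less_induct)
  case less
  have fin: "finite (nodes G)" using G by (simp add: ancestral_graph_def mixed_graph_def)
  then have n: "num_nodes G > 0" using X by (auto simp: num_nodes_def card_gt_0_iff)
  define B where "B = 75 * (num_nodes G + num_edges G)"
  define S where "S = (\<lambda>I R. {Z. m_separator G X Y Z \<and> I \<subseteq> Z \<and> Z \<subseteq> R})"
  have "runs (ListSep G X Y I R) (\<lambda>t _. call_trace B (card (R - I)) (S I R) t)"
    unfolding ListSep.simps[of G X Y I R]
  proof (rule runs_bind_takes, rule takes_mono,
      rule takes_FindSep[OF G X(1) less.prems(1) X(3) Y(1) less.prems(2-4)], goal_cases)
    case (1 k s)
    then have k: "k \<le> 70 * (num_nodes G + num_edges G)" and s: "s \<noteq> None \<longleftrightarrow> S I R \<noteq> {}"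
      by (auto simp: S_def)
    show ?case
    proof (cases "s = None")
      case True
      then show ?thesis using s k by (auto simp: call_trace_def B_def)
    next
      case False
      then have ne: "S I R \<noteq> {}" using s by simp
      show ?thesis
      proof (cases "I = R")
        case True
        then have "S I R = {I}" using ne by (auto simp: S_def)
        moreover have "k + (card (nodes G) + card (nodes G)) \<le> B"
          using k by (simp add: B_def num_nodes_def)
        ultimately have leaf: "call_trace B (card (R - I)) (S I R)
            (replicate (k + (card (nodes G) + card (nodes G))) Tick @ [Output I])"
          using True call_trace_leaf by simp
        show ?thesis
          apply (simp only: False if_True simp_thms)
          apply (rule runs_bind_set_operation)
          apply (simp only: True simp_thms if_True runs_print_set)
          using leaf unfolding True replicate_add append_assoc .
      next
        case IR: False
        have finD: "finite (R - I)" using less.prems(3) fin by (auto intro: finite_subset)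
        let ?n = "card (nodes G)"
        \<comment> \<open>The terms stand for \<open>FindSep\<close>, \<open>equal_set\<close>,
          \<open>diff_set\<close>, \<open>pick\<close>, \<open>union_set\<close> and
          \<open>diff_set\<close>. All but the first cost at most \<open>5 * ?n\<close> together,
          which raises \<open>70\<close> to \<open>75\<close>.\<close>
        let ?c = "k + (?n + (?n + (1 + (?n + ?n))))"
        have c: "?c \<le> B" using k n by (simp add: B_def num_nodes_def)
        have rec: "runs (ListSep G X Y (I \<union> {v}) R) (\<lambda>t _.
            runs (ListSep G X Y I (R - {v})) (\<lambda>u _.
              call_trace B (card (R - I)) (S I R) (replicate ?c Tick @ t @ u)))"
          if v: "v \<in> R - I" for v
        proof -
          have diff: "R - (I \<union> {v}) = (R - I) - {v}" "R - {v} - I = (R - I) - {v}" by auto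
          have card: "card (R - (I \<union> {v})) < card (R - I)" "card (R - {v} - I) < card (R - I)"
            "card (R - I) = Suc (card (R - (I \<union> {v})))" "card (R - {v} - I) = card (R - (I \<union> {v}))"
            unfolding diff using card_Suc_Diff1[OF finD v] by simp_all
          have S_eq: "S I R = S (I \<union> {v}) R \<union> S I (R - {v})"
            and disj: "S (I \<union> {v}) R \<inter> S I (R - {v}) = {}"
            using v by (auto simp: S_def)
          show ?thesis
          proof (rule runs_mono[OF less.hyps[OF card(1), folded B_def]], goal_cases)
            case (5 t)
            then have t: "call_trace B (card (R - (I \<union> {v}))) (S (I \<union> {v}) R) t"
              by (simp add: S_def)
            show ?case
            proof (rule runs_mono[OF less.hyps[OF card(2), folded B_def]], goal_cases)
              case (5 u)
              then have "call_trace B (card (R - (I \<union> {v}))) (S I (R - {v})) u"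
                unfolding S_def card(4) .
              then show ?case
                unfolding S_eq card(3) using call_trace_node[OF t _ c disj] ne S_eq by blast
            qed (use less.prems v in auto)
          qed (use less.prems v in auto)
        qed
        show ?thesis
          apply (simp only: False if_True simp_thms)
          apply (rule runs_bind_set_operation, simp only: IR if_False)
          apply (rule runs_bind_set_operation)
        proof (rule runs_bind_takes, rule takes_pick[OF finD], goal_cases)
          case 1
          show ?case using IR less.prems(4) by blast
        next
          case (2 v)
          show ?case
          proof (intro runs_bind_set_operation, rule runs_bind, rule runs_mono[OF rec[OF 2]], goal_cases)
            case (1 t _)
            then show ?case
              by (rule runs_mono) (simp only: replicate_add append_assoc)
          qed
        qed
      qed
    qed
  qed
  then show ?case by (simp add: B_def S_def)
qed

theorem proposition9:
  shows "\<exists>C::nat. \<forall>(G::'a mixed_graph) X Y I R.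
    ancestral_graph G \<and>
    X \<subseteq> nodes G \<and> Y \<subseteq> nodes G \<and> R \<subseteq> nodes G \<and>
    X \<inter> Y = {} \<and> X \<inter> R = {} \<and> Y \<inter> R = {} \<and>
    X \<noteq> {} \<and> Y \<noteq> {} \<and> I \<subseteq> R \<longrightarrow>
    enumerates_with_delay (ListSep G X Y I R)
      {Z. m_separator G X Y Z \<and> I \<subseteq> Z \<and> Z \<subseteq> R}
      (C * (num_nodes G * (num_nodes G + num_edges G)))"
proof (intro exI[of _ 300] allI impI, elim conjE)
  fix G :: "'a mixed_graph" and X Y I R
  assume *: "ancestral_graph G" "X \<subseteq> nodes G" "Y \<subseteq> nodes G" "R \<subseteq> nodes G"
    "X \<inter> R = {}" "Y \<inter> R = {}" "X \<noteq> {}" "I \<subseteq> R"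
  let ?S = "{Z. m_separator G X Y Z \<and> I \<subseteq> Z \<and> Z \<subseteq> R}"
  let ?h = "card (R - I)" and ?B = "75 * (num_nodes G + num_edges G)"
  have fin: "finite (nodes G)" using * by (simp add: ancestral_graph_def mixed_graph_def)
  have "?h \<le> num_nodes G" unfolding num_nodes_def using * fin by (intro card_mono) auto
  moreover have "1 \<le> num_nodes G"
    using * fin by (auto simp: num_nodes_def Suc_le_eq card_gt_0_iff)
  \<comment> \<open>The depth is at most the number of nodes, which is at least one;
    \<open>4 * 75\<close> then gives the constant \<open>300\<close>.\<close>
  ultimately have "3 * ?h + 1 \<le> 4 * num_nodes G" by simp
  then have "(3 * ?h + 1) * ?B \<le> 4 * num_nodes G * ?B" by (rule mult_le_mono1)
  then have bound: "(3 * ?h + 1) * ?B \<le> 300 * (num_nodes G * (num_nodes G + num_edges G))"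
    by (simp add: algebra_simps)
  have "runs (ListSep G X Y I R) (\<lambda>t _. call_trace ?B ?h ?S t)"
    using * by (intro runs_ListSep)
  then have "runs (ListSep G X Y I R) (\<lambda>t _. distinct (outputs t) \<and> set (outputs t) = ?S \<and>
      (\<forall>k\<in>set (delays 0 t). k \<le> 300 * (num_nodes G * (num_nodes G + num_edges G))))"
  proof (rule runs_mono, goal_cases)
    case (1 t)
    note t = this
    show ?case
      using call_trace_delays(1,2)[OF t] le_trans[OF call_trace_delays(3)[OF t] bound] by simp
  qed
  then show "enumerates_with_delay (ListSep G X Y I R) ?S
      (300 * (num_nodes G * (num_nodes G + num_edges G)))"
    by (simp add: enumerates_with_delay_def runs_def)
qed

end
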